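(* Let $G$ be a non-trivial finite abelian group, let $\mathbf{A}$ be a commutative $\mathbb{Q}$-algebra with unit, let $Z_{\mathbf A}:\mathfrak{H}^0_G\to\mathbf{A}$ be a $\mathbb{Q}$-linear map and let $d>0$ be a divisor of the order of $G$. Assume that: (i) $Z_{\mathbf A}\in\mathsf{EDS}(G)(\mathbf{A})$; (ii) $Z_{\mathbf A}\circ p^d_\sharp(x_h)=Z_{\mathbf A}\circ i_d^\sharp(x_h)$ for any $h\in G^d\smallsetminus\{1\}$; (iii) $Z_{\mathbf A}\circ p^d_\sharp(x_{h_1}x_{h_2})=Z_{\mathbf A}\circ i_d^\sharp(x_{h_1}x_{h_2})$ for any $h_1\in G^d\smallsetminus\{1\}$ and $h_2\in G^d$ (the equalities (ii), (iii) being in $\mathbf{A}$). Then the following equality in $\mathbf{A}[T]$ holds for any $h_1,h_2\in G^d\sqcup\{0\}$: $$\overline{Z}^{\mathrm{sh}}_{\mathbf A}\circ p^d_\sharp(x_{h_1}x_{h_2})=\sigma_{Z_{\mathbf A}}\circ\overline{Z}^{\mathrm{sh}}_{\mathbf A}\circ i_d^\sharp(x_{h_1}x_{h_2}).$$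
   Context: $G$ is a finite abelian group written multiplicatively with identity $1$; $X_G=\{x_0\}\sqcup\{x_g: g\in G\}$ ($x_1$ is the letter attached to $1\in G$). $\mathfrak{H}_G=\mathbb{Q}\langle X_G\rangle$ is the free associative unital algebra, $\mathfrak{H}^1_G=\mathbb{Q}+\sum_{g\in G}\mathfrak{H}_Gx_g$ and $\mathfrak{H}^0_G=\mathbb{Q}+\sum_{g\in G}x_0\mathfrak{H}_Gx_g+\sum_{g\in G\smallsetminus\{1\}}x_g\mathfrak{H}^1_G$. Put $y_{n,g}=x_0^{n-1}x_g$ ($n\geq1$, $g\in G$); $\mathfrak{H}^1_G$ is the free algebra on the $y_{n,g}$. Shuffle product $\mathrm{sh}$ on $\mathfrak{H}_G$: $\mathbb{Q}$-bilinear, $1\,\mathrm{sh}\,w=w\,\mathrm{sh}\,1=w$, $uw_1\,\mathrm{sh}\,vw_2=u(w_1\,\mathrm{sh}\,vw_2)+v(uw_1\,\mathrm{sh}\,w_2)$ for letters $u,v\in X_G$ and words $w_1,w_2$. Harmonic product $*$ on $\mathfrak{H}^1_G$: $\mathbb{Q}$-bilinear, $1*w=w*1=w$, $y_{n_1,g_1}w_1*y_{n_2,g_2}w_2=y_{n_1,g_1}(w_1*y_{n_2,g_2}w_2)+y_{n_2,g_2}(y_{n_1,g_1}w_1*w_2)+y_{n_1+n_2,g_1g_2}(w_1*w_2)$. The commutative algebras $\mathfrak{H}_{G,\mathrm{sh}},\mathfrak{H}^1_{G,\mathrm{sh}},\mathfrak{H}^0_{G,\mathrm{sh}}$ and $\mathfrak{H}^1_{G,*}$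 are the corresponding spaces with the indicated products. Algebra homomorphisms are unital. $\mathrm{q}_G$ is the $\mathbb{Q}$-linear automorphism of $\mathfrak{H}_G$ with $\mathrm{q}_G(x_0^{n_1-1}x_{g_1}x_0^{n_2-1}x_{g_2}\cdots x_0^{n_r-1}x_{g_r}x_0^{n_{r+1}-1})=x_0^{n_1-1}x_{g_1}x_0^{n_2-1}x_{g_2g_1^{-1}}\cdots x_0^{n_r-1}x_{g_rg_{r-1}^{-1}}x_0^{n_{r+1}-1}$; it restricts to $\mathfrak{H}^1_G$ and $\mathfrak{H}^0_G$. $\overline{\mathrm{reg}}^T:\mathfrak{H}_{G,\mathrm{sh}}\to\mathfrak{H}^0_{G,\mathrm{sh}}[T]$ is the unique $\mathbb{Q}$-algebra homomorphism that is the identity on $\mathfrak{H}^0_G$ and sends $x_0\mapsto0$, $x_1\mapsto T$. For a $\mathbb{Q}$-algebra homomorphism $Z_{\mathbf A}:\mathfrak{H}^0_{G,\mathrm{sh}}\to\mathbf A$, $\overline{Z}^{\mathrm{sh}}_{\mathbf A}:\mathfrak{H}_{G,\mathrm{sh}}\to\mathbf{A}[T]$ is $\overline{\mathrm{reg}}^T$ followed by applying $Z_{\mathbf A}$ to coefficients, and $Z^{\mathrm{sh}}_{\mathbf A}$ is its restriction to $\mathfrak{H}^1_G$. $\rho_{Z_{\mathbf A}}$ is the $\mathbf{A}$-module automorphism of $\mathbf{A}[T]$ determined (coefficientwise in a formal parameter $u$) by $\rho_{Z_{\mathbf A}}(\exp(Tu))=\exp\big(\sum_{n\geq2}\frac{(-1)^n}{n}Z_{\mathbf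 A}(x_0^{n-1}x_1)u^n\big)\exp(Tu)$. $\mathsf{EDS}(G)(\mathbf A)$ is the set of $\mathbb{Q}$-linear maps $Z_{\mathbf A}:\mathfrak{H}^0_G\to\mathbf A$ such that (a) $Z_{\mathbf A}:\mathfrak{H}^0_{G,\mathrm{sh}}\to\mathbf A$ is an algebra homomorphism, and (b) $\rho_{Z_{\mathbf A}}^{-1}\circ Z^{\mathrm{sh}}_{\mathbf A}\circ\mathrm{q}_G^{-1}:\mathfrak{H}^1_{G,*}\to\mathbf{A}[T]$ is an algebra homomorphism. For $d$ dividing $|G|$: $G^d=\{g^d: g\in G\}$, $p^d:G\to G^d$, $g\mapsto g^d$. $i_d^\sharp:\mathfrak{H}_{G^d}\to\mathfrak{H}_G$ is the (concatenation) algebra homomorphism $x_0\mapsto x_0$, $x_h\mapsto x_h$ ($h\in G^d$). $p^d_\sharp:\mathfrak{H}_{G^d}\to\mathfrak{H}_G$ is the (concatenation) algebra homomorphism $x_0\mapsto|\ker(p^d)|\,x_0$, $x_h\mapsto\sum_{g\in G,\,g^d=h}x_g$ ($h\in G^d$). $\sigma_{Z_{\mathbf A}}$ (depending on $d$) is the $\mathbf A$-module automorphism of $\mathbf A[T]$ determined by $\sigma_{Z_{\mathbf A}}(\exp(Tu))=\exp\big(\sum_{g^d=1,\,g\neq1}Z_{\mathbf A}(x_g)u\big)\exp(Tu)$. *)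

theory Defs
  imports
    Complex_Main
    "HOL-Algebra.Coset"
    "HOL-Library.Poly_Mapping"
    "HOL-Computational_Algebra.Polynomial"
    "HOL-Computational_Algebra.Formal_Power_Series"
begin

subsection \<open>Rational vector spaces and commutative unital rational algebras\<close>

text \<open>These classes mirror \<open>real_vector\<close> and \<open>real_algebra_1\<close>.\<close>

class scaleQ =
  fixes scaleQ :: "rat \<Rightarrow> 'a \<Rightarrow> 'a"  (infixr \<open>*\<^sub>Q\<close> 75)

class rat_vector = scaleQ + ab_group_add +
  assumes scaleQ_add_right: "c *\<^sub>Q (x + y) = c *\<^sub>Q x + c *\<^sub>Q y"
    and scaleQ_add_left: "(b + c) *\<^sub>Q x = b *\<^sub>Q x + c *\<^sub>Q x"
    and scaleQ_scaleQ: "b *\<^sub>Q c *\<^sub>Q x = (b * c) *\<^sub>Q x"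
    and scaleQ_one: "1 *\<^sub>Q x = x"

class comm_rat_algebra_1 = rat_vector + comm_ring_1 +
  assumes mult_scaleQ_left: "(c *\<^sub>Q x) * y = c *\<^sub>Q (x * y)"

lemma scaleQ_zero_right [simp]: "c *\<^sub>Q (0 :: 'a :: rat_vector) = 0"
  using scaleQ_add_right[of c "0 :: 'a" 0] by simp

instantiation rat :: comm_rat_algebra_1
begin
definition scaleQ_rat :: "rat \<Rightarrow> rat \<Rightarrow> rat" where "scaleQ_rat = (*)"
instance by standard (simp_all add: scaleQ_rat_def algebra_simps)
end

instantiation poly_mapping :: (type, rat_vector) rat_vector
begin
definition scaleQ_poly_mapping :: "rat \<Rightarrow> ('a \<Rightarrow>\<^sub>0 'b) \<Rightarrow> ('a \<Rightarrow>\<^sub>0 'b)"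
  where "scaleQ_poly_mapping c p = Poly_Mapping.map (scaleQ c) p"

lemma lookup_scaleQ: "Poly_Mapping.lookup (c *\<^sub>Q p) k = c *\<^sub>Q Poly_Mapping.lookup p k"
  for p :: "'a \<Rightarrow>\<^sub>0 'b"
  by (simp add: scaleQ_poly_mapping_def Poly_Mapping.map.rep_eq when_def)

instance
  by standard (auto intro!: poly_mapping_eqI
      simp: lookup_scaleQ lookup_add scaleQ_add_right scaleQ_add_left scaleQ_scaleQ scaleQ_one)
end

instantiation poly :: (rat_vector) rat_vector
begin
definition scaleQ_poly :: "rat \<Rightarrow> 'a poly \<Rightarrow> 'a poly"
  where "scaleQ_poly c p = map_poly (scaleQ c) p"

lemma coeff_scaleQ: "coeff (c *\<^sub>Q p) n = c *\<^sub>Q coeff p n"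
  for p :: "'a poly"
  by (simp add: scaleQ_poly_def coeff_map_poly)

instance
  by standard (auto intro!: poly_eqI
      simp: coeff_scaleQ scaleQ_add_right scaleQ_add_left scaleQ_scaleQ scaleQ_one)
end

lemma scaleQ_sum: "c *\<^sub>Q (\<Sum>i\<in>I. f i) = (\<Sum>i\<in>I. c *\<^sub>Q f i)"
  for f :: "'i \<Rightarrow> 'a :: rat_vector"
  by (induction I rule: infinite_finite_induct) (simp_all add: scaleQ_add_right)

instance poly :: (comm_rat_algebra_1) comm_rat_algebra_1
  by standard
     (auto intro!: poly_eqI simp: coeff_scaleQ coeff_mult mult_scaleQ_left scaleQ_sum)

definition rat_linear_on :: "'a :: rat_vector set \<Rightarrow> ('a \<Rightarrow> 'b :: rat_vector) \<Rightarrow> bool" where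
  "rat_linear_on S f \<longleftrightarrow>
     (\<forall>v\<in>S. \<forall>w\<in>S. f (v + w) = f v + f w) \<and> (\<forall>c. \<forall>v\<in>S. f (c *\<^sub>Q v) = c *\<^sub>Q f v)"

text \<open>
  Unital homomorphisms of rational algebras. The products and units are explicit arguments,
  since the same space of noncommutative polynomials carries several products.
\<close>
definition rat_alg_hom_on ::
  "'a :: rat_vector set \<Rightarrow> ('a \<Rightarrow> 'a \<Rightarrow> 'a) \<Rightarrow> 'a \<Rightarrow>
   ('b :: rat_vector \<Rightarrow> 'b \<Rightarrow> 'b) \<Rightarrow> 'b \<Rightarrow> ('a \<Rightarrow> 'b) \<Rightarrow> bool" where
  "rat_alg_hom_on S mS oneS mT oneT f \<longleftrightarrow>
     rat_linear_on S f \<and> f oneS = oneT \<and> (\<forall>v\<in>S. \<forall>w\<in>S. f (mS v w) = mT (f v) (f w))"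


subsection \<open>Noncommutative polynomials\<close>

text \<open>
  Words form the free monoid under concatenation; with this instance the product and unit of
  type \<open>'l list \<Rightarrow>\<^sub>0 rat\<close> are those of the free associative unital algebra on \<open>'l\<close>.
\<close>
instantiation list :: (type) monoid_add
begin
definition zero_list :: "'a list" where "zero_list = []"
definition plus_list :: "'a list \<Rightarrow> 'a list \<Rightarrow> 'a list" where "plus_list = (@)"
instance by standard (simp_all add: zero_list_def plus_list_def)
end

text \<open>The letter \<open>x\<^sub>0\<close> is encoded by \<open>None\<close> and \<open>x\<^sub>g\<close> by \<open>Some g\<close>.\<close>
type_synonym 'g word = "'g option list"
type_synonym 'g ncpoly = "'g option list \<Rightarrow>\<^sub>0 rat"

definition word_poly :: "'g word \<Rightarrow> 'g ncpoly" where
  "word_poly w = Poly_Mapping.single w 1"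

definition xx :: "'g option \<Rightarrow> 'g ncpoly" where
  "xx l = word_poly [l]"

text \<open>Linear and bilinear extension of maps defined on words.\<close>
definition lin_ext :: "('g word \<Rightarrow> 'v :: rat_vector) \<Rightarrow> 'g ncpoly \<Rightarrow> 'v" where
  "lin_ext f p = (\<Sum>w\<in>Poly_Mapping.keys p. Poly_Mapping.lookup p w *\<^sub>Q f w)"

definition bilin_ext ::
  "('g word \<Rightarrow> 'g word \<Rightarrow> 'v :: rat_vector) \<Rightarrow> 'g ncpoly \<Rightarrow> 'g ncpoly \<Rightarrow> 'v" where
  "bilin_ext f p q = lin_ext (\<lambda>v. lin_ext (\<lambda>w. f v w) q) p"

text \<open>The homomorphism of concatenation algebras with prescribed values on the letters.\<close>
definition free_hom :: "('g option \<Rightarrow> 'g ncpoly) \<Rightarrow> 'g ncpoly \<Rightarrow> 'g ncpoly" where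
  "free_hom f = lin_ext (\<lambda>w. prod_list (map f w))"

definition letters :: "('g, 'm) monoid_scheme \<Rightarrow> 'g option set" where
  "letters G = insert None (Some ` carrier G)"

definition HG :: "('g, 'm) monoid_scheme \<Rightarrow> 'g ncpoly set" where
  "HG G = {p. Poly_Mapping.keys p \<subseteq> lists (letters G)}"

definition HG1 :: "('g, 'm) monoid_scheme \<Rightarrow> 'g ncpoly set" where
  "HG1 G = {c *\<^sub>Q 1 + (\<Sum>g\<in>carrier G. a g * xx (Some g)) | c a. \<forall>g\<in>carrier G. a g \<in> HG G}"

definition HG0 :: "('g, 'm) monoid_scheme \<Rightarrow> 'g ncpoly set" where
  "HG0 G = {c *\<^sub>Q 1 + (\<Sum>g\<in>carrier G. xx None * a g * xx (Some g))
             + (\<Sum>g\<in>carrier G - {\<one>\<^bsub>G\<^esub>}. xx (Some g) * b g) | c a b.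
           (\<forall>g\<in>carrier G. a g \<in> HG G) \<and> (\<forall>g\<in>carrier G - {\<one>\<^bsub>G\<^esub>}. b g \<in> HG1 G)}"


subsection \<open>Shuffle and harmonic products\<close>

fun sh_word :: "'g word \<Rightarrow> 'g word \<Rightarrow> 'g ncpoly" where
  "sh_word [] w = word_poly w"
| "sh_word w [] = word_poly w"
| "sh_word (u # w1) (v # w2) = xx u * sh_word w1 (v # w2) + xx v * sh_word (u # w1) w2"

definition sh :: "'g ncpoly \<Rightarrow> 'g ncpoly \<Rightarrow> 'g ncpoly" where
  "sh = bilin_ext sh_word"

definition yy :: "nat \<Rightarrow> 'g \<Rightarrow> 'g ncpoly" where
  "yy n g = xx None ^ (n - 1) * xx (Some g)"

definition y_word :: "(nat \<times> 'g) list \<Rightarrow> 'g ncpoly" where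
  "y_word w = prod_list (map (\<lambda>(n, g). yy n g) w)"

text \<open>
  \<open>to_y 1\<close> is the decomposition of a word that does not end in \<open>x\<^sub>0\<close> into factors
  \<open>yy n g\<close>; the first argument is one more than the number of letters \<open>x\<^sub>0\<close> read since the
  last letter \<open>x\<^sub>g\<close>. Its value on words ending in \<open>x\<^sub>0\<close>, which do not occur in \<open>HG1 G\<close>, is
  irrelevant.
\<close>
fun to_y :: "nat \<Rightarrow> 'g word \<Rightarrow> (nat \<times> 'g) list" where
  "to_y n [] = []"
| "to_y n (None # w) = to_y (n + 1) w"
| "to_y n (Some g # w) = (n, g) # to_y 1 w"

fun harm_word ::
  "('g, 'm) monoid_scheme \<Rightarrow> (nat \<times> 'g) list \<Rightarrow> (nat \<times> 'g) list \<Rightarrow> 'g ncpoly" where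
  "harm_word G [] w = y_word w"
| "harm_word G w [] = y_word w"
| "harm_word G ((n1, g1) # w1) ((n2, g2) # w2) =
     yy n1 g1 * harm_word G w1 ((n2, g2) # w2)
     + yy n2 g2 * harm_word G ((n1, g1) # w1) w2
     + yy (n1 + n2) (g1 \<otimes>\<^bsub>G\<^esub> g2) * harm_word G w1 w2"

definition harm :: "('g, 'm) monoid_scheme \<Rightarrow> 'g ncpoly \<Rightarrow> 'g ncpoly \<Rightarrow> 'g ncpoly" where
  "harm G = bilin_ext (\<lambda>v w. harm_word G (to_y 1 v) (to_y 1 w))"

text \<open>\<open>q_word G g w\<close> is the transform of the word \<open>w\<close> when the preceding group letter is \<open>x\<^sub>g\<close>.\<close>
fun q_word :: "('g, 'm) monoid_scheme \<Rightarrow> 'g \<Rightarrow> 'g word \<Rightarrow> 'g word" where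
  "q_word G h [] = []"
| "q_word G h (None # w) = None # q_word G h w"
| "q_word G h (Some g # w) = Some (g \<otimes>\<^bsub>G\<^esub> inv\<^bsub>G\<^esub> h) # q_word G g w"

definition qG :: "('g, 'm) monoid_scheme \<Rightarrow> 'g ncpoly \<Rightarrow> 'g ncpoly" where
  "qG G = lin_ext (\<lambda>w. word_poly (q_word G \<one>\<^bsub>G\<^esub> w))"


subsection \<open>Shuffle regularization\<close>

text \<open>
  The product of polynomials in \<open>T\<close> whose coefficients are multiplied by the shuffle product.
\<close>
definition sh_poly :: "'g ncpoly poly \<Rightarrow> 'g ncpoly poly \<Rightarrow> 'g ncpoly poly" where
  "sh_poly P Q =
     (\<Sum>i\<le>degree P. \<Sum>j\<le>degree Q. monom (sh (coeff P i) (coeff Q j)) (i + j))"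

definition is_reg :: "('g, 'm) monoid_scheme \<Rightarrow> ('g ncpoly \<Rightarrow> 'g ncpoly poly) \<Rightarrow> bool" where
  "is_reg G R \<longleftrightarrow>
     rat_alg_hom_on (HG G) sh 1 sh_poly [:1:] R \<and>
     (\<forall>v\<in>HG G. \<forall>n. coeff (R v) n \<in> HG0 G) \<and>
     (\<forall>v\<in>HG0 G. R v = [:v:]) \<and>
     R (xx None) = 0 \<and>
     R (xx (Some \<one>\<^bsub>G\<^esub>)) = [:0, 1:]"

text \<open>
  These conditions determine the map uniquely on \<open>HG G\<close>. Its values outside \<open>HG G\<close> are
  arbitrary, whence \<open>SOME\<close> instead of \<open>THE\<close>.
\<close>
definition reg :: "('g, 'm) monoid_scheme \<Rightarrow> 'g ncpoly \<Rightarrow> 'g ncpoly poly" where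
  "reg G = (SOME R. is_reg G R)"

definition Z_sh ::
  "('g, 'm) monoid_scheme \<Rightarrow> ('g ncpoly \<Rightarrow> 'a :: comm_rat_algebra_1) \<Rightarrow> 'g ncpoly \<Rightarrow> 'a poly" where
  "Z_sh G Z v = map_poly Z (reg G v)"


subsection \<open>Module automorphisms given by exponential series\<close>

text \<open>
  The exponential of a power series with zero constant coefficient; for such \<open>F\<close> the
  coefficient of index \<open>n\<close> in \<open>F ^ k\<close> vanishes for \<open>k > n\<close>.
\<close>
definition exp_fps :: "'b :: comm_rat_algebra_1 fps \<Rightarrow> 'b fps" where
  "exp_fps F = Abs_fps (\<lambda>n. \<Sum>k\<le>n. (1 / fact k) *\<^sub>Q fps_nth (F ^ k) n)"

text \<open>The series \<open>exp (T u)\<close> in the formal parameter \<open>u\<close>, over polynomials in \<open>T\<close>.\<close>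
definition exp_Tu :: "'a :: comm_rat_algebra_1 poly fps" where
  "exp_Tu = exp_fps (fps_const [:0, 1:] * fps_X)"

text \<open>The module automorphism sending \<open>exp (T u)\<close> to \<open>exp F * exp (T u)\<close>, coefficientwise in \<open>u\<close>.\<close>
definition exp_auto :: "'a :: comm_rat_algebra_1 fps \<Rightarrow> 'a poly \<Rightarrow> 'a poly" where
  "exp_auto F = (THE f. module_hom smult smult f \<and> bij f \<and>
     Abs_fps (\<lambda>n. f (fps_nth exp_Tu n)) =
       exp_fps (Abs_fps (\<lambda>n. [:fps_nth F n:])) * exp_Tu)"

definition rho ::
  "('g, 'm) monoid_scheme \<Rightarrow> ('g ncpoly \<Rightarrow> 'a :: comm_rat_algebra_1) \<Rightarrow> 'a poly \<Rightarrow> 'a poly" where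
  "rho G Z = exp_auto (Abs_fps (\<lambda>n. if n \<ge> 2
     then ((-1) ^ n / of_nat n) *\<^sub>Q Z (xx None ^ (n - 1) * xx (Some \<one>\<^bsub>G\<^esub>)) else 0))"

definition EDS :: "('g, 'm) monoid_scheme \<Rightarrow> ('g ncpoly \<Rightarrow> 'a :: comm_rat_algebra_1) set" where
  "EDS G = {Z. rat_linear_on (HG0 G) Z \<and>
     rat_alg_hom_on (HG0 G) sh 1 (*) 1 Z \<and>
     rat_alg_hom_on (HG1 G) (harm G) 1 (*) 1
       (inv_into UNIV (rho G Z) \<circ> Z_sh G Z \<circ> inv_into (HG G) (qG G))}"


subsection \<open>The maps attached to a divisor of the group order\<close>

definition G_pow :: "('g, 'm) monoid_scheme \<Rightarrow> nat \<Rightarrow> 'g set" where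
  "G_pow G d = (\<lambda>g. g [^]\<^bsub>G\<^esub> d) ` carrier G"

definition ker_pow :: "('g, 'm) monoid_scheme \<Rightarrow> nat \<Rightarrow> 'g set" where
  "ker_pow G d = kernel G G (\<lambda>g. g [^]\<^bsub>G\<^esub> d)"

text \<open>
  The source of the next two maps is the algebra of the subgroup \<open>G_pow G d\<close>, whose letters
  are a subset of those of \<open>G\<close>.
\<close>
definition i_sharp :: "'g ncpoly \<Rightarrow> 'g ncpoly" where
  "i_sharp = free_hom xx"

definition p_sharp :: "('g, 'm) monoid_scheme \<Rightarrow> nat \<Rightarrow> 'g ncpoly \<Rightarrow> 'g ncpoly" where
  "p_sharp G d = free_hom (\<lambda>l. case l of
       None \<Rightarrow> of_nat (card (ker_pow G d)) *\<^sub>Q xx None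
     | Some h \<Rightarrow> (\<Sum>g\<in>{g \<in> carrier G. g [^]\<^bsub>G\<^esub> d = h}. xx (Some g)))"

definition sigma ::
  "('g, 'm) monoid_scheme \<Rightarrow> nat \<Rightarrow> ('g ncpoly \<Rightarrow> 'a :: comm_rat_algebra_1) \<Rightarrow> 'a poly \<Rightarrow> 'a poly" where
  "sigma G d Z =
     exp_auto (fps_const (\<Sum>g\<in>ker_pow G d - {\<one>\<^bsub>G\<^esub>}. Z (xx (Some g))) * fps_X)"

end

theory Submission
  imports Defs
begin

text \<open>
  In weight two the claim comes down to the weight two distribution relations of depth one. Write
  \<open>z(a)\<close>, \<open>z(a,b)\<close>, \<open>w(a)\<close> for the values of \<open>Z\<close> at \<open>x\<^sub>a\<close>, \<open>x\<^sub>a x\<^sub>b\<close>, \<open>x\<^sub>0 x\<^sub>a\<close>, and \<open>K\<close> for the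
  kernel of the power map \<open>g \<mapsto> g\<^sup>d\<close>. The point is that
  \<open>|K| (\<Sum>g | g\<^sup>d = h. w(g)) = w(h)\<close> for every \<open>h\<close> in the image of the power map
  (lemma \<open>distribution\<close>); the remaining cases follow from this, from the assumptions \<open>ii\<close> and \<open>iii\<close>,
  and from the shuffle identity \<open>u v + v u = u sh v\<close> for linear combinations \<open>u\<close>, \<open>v\<close> of letters.

  The double shuffle relations that are used are \<open>z(a) z(b) = z(a,b) + z(b,a)\<close> (shuffle) and
  \<open>z(a) z(b) = z(a,ab) + z(b,ab) + w(ab)\<close> (harmonic) for \<open>a, b \<noteq> 1\<close>, and the regularized relation
  \<open>w(b) = z(b,1) - z(b,b)\<close> for \<open>b \<noteq> 1\<close>, which is the harmonic relation with \<open>a = 1\<close>. For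
  \<open>h \<noteq> 1\<close> they show that \<open>z(g,k) - z(g,gk)\<close>, summed over the fibre \<open>F\<close> of \<open>h\<close> with \<open>k \<in> K\<close>
  fixed, is \<open>\<Sum>g\<in>F. w(g)\<close> (lemma \<open>coset_relation\<close>), while by \<open>iii\<close> the sum over all
  \<open>g \<in> F\<close>, \<open>k \<in> K\<close> is \<open>z(h,1) - z(h,h) = w(h)\<close>. For \<open>h = 1\<close> no distribution hypothesis is
  needed: comparison of the two expansions of \<open>\<Sum> z(a) z(b)\<close> over \<open>a, b \<in> K - {1}\<close> gives the relation
  for any subgroup \<open>K\<close> (lemma \<open>distribution_at_one\<close>).

  These computations need that the regularization and the exponential automorphisms, which are
  introduced by descriptions, do have the properties that describe them. Deleting a leading letter
  \<open>x\<^sub>1\<close> and deleting a trailing letter \<open>x\<^sub>0\<close> are commuting locally nilpotent derivations of the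
  shuffle algebra, with common kernel \<open>HG0 G\<close> in \<open>HG G\<close>. For a locally nilpotent derivation \<open>D\<close> with
  an element \<open>s\<close> such that \<open>D s = 1\<close>, the Taylor map \<open>exp (- s D)\<close> is an algebra homomorphism
  onto the kernel of \<open>D\<close> that kills \<open>s\<close>, and \<open>exp ((T - s) D)\<close> is one that sends \<open>s\<close> to \<open>T\<close>.
  Composing the first for \<open>x\<^sub>0\<close> with the second for \<open>x\<^sub>1\<close> gives the regularization
  (lemma \<open>is_reg_reg\<close>). The exponential automorphisms exist because they are unitriangular with
  respect to the powers of \<open>T\<close> (lemma \<open>exp_auto_spec\<close>).
\<close>

section \<open>Linear extension of maps on words\<close>

lemma scaleQ_zero_left [simp]: "0 *\<^sub>Q (x :: 'a :: rat_vector) = 0"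
  using scaleQ_add_left[of 0 0 x] by simp

lemma scaleQ_minus_left: "(- c) *\<^sub>Q (x :: 'a :: rat_vector) = - (c *\<^sub>Q x)"
  using scaleQ_add_left[of "- c" c x] by (simp add: eq_neg_iff_add_eq_0)

lemma mult_scaleQ_right: "x * (c *\<^sub>Q y) = c *\<^sub>Q (x * y)" for x :: "'a :: comm_rat_algebra_1"
  by (metis mult.commute mult_scaleQ_left)

lemma of_nat_scaleQ: "of_nat n *\<^sub>Q x = of_nat n * x" for x :: "'a :: comm_rat_algebra_1"
  by (induction n) (simp_all add: scaleQ_add_left scaleQ_one algebra_simps)

lemma lin_ext_superset:
  assumes "finite S" "Poly_Mapping.keys p \<subseteq> S"
  shows "lin_ext f p = (\<Sum>w\<in>S. Poly_Mapping.lookup p w *\<^sub>Q f w)"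
  unfolding lin_ext_def using assms
  by (intro sum.mono_neutral_left) (auto simp: in_keys_iff)

lemma lin_ext_add: "lin_ext f (p + q) = lin_ext f p + lin_ext f q"
proof -
  let ?S = "Poly_Mapping.keys p \<union> Poly_Mapping.keys q"
  have "finite ?S" "Poly_Mapping.keys (p + q) \<subseteq> ?S"
    using keys_add[of p q] by auto
  then show ?thesis
    by (simp add: lin_ext_superset[of ?S] lookup_add scaleQ_add_left sum.distrib)
qed

lemma lin_ext_scaleQ: "lin_ext f (c *\<^sub>Q p) = c *\<^sub>Q lin_ext f p"
proof -
  have "Poly_Mapping.keys (c *\<^sub>Q p) \<subseteq> Poly_Mapping.keys p"
    by (auto simp: in_keys_iff lookup_scaleQ)
  then show ?thesis
    by (simp add: lin_ext_superset[of "Poly_Mapping.keys p"] lookup_scaleQ scaleQ_sum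
        scaleQ_scaleQ scaleQ_rat_def)
qed

lemma lin_ext_zero [simp]: "lin_ext f 0 = 0"
  by (simp add: lin_ext_def)

lemma lin_ext_word_poly [simp]: "lin_ext f (word_poly w) = f w"
  by (simp add: lin_ext_def word_poly_def scaleQ_one)

lemma lin_ext_sum: "lin_ext f (\<Sum>i\<in>I. p i) = (\<Sum>i\<in>I. lin_ext f (p i))"
  by (induction I rule: infinite_finite_induct) (simp_all add: lin_ext_add)

lemma lin_ext_fun_add: "lin_ext (\<lambda>w. f w + g w) p = lin_ext f p + lin_ext g p"
  by (simp add: lin_ext_def scaleQ_add_right sum.distrib)

lemma lin_ext_fun_scaleQ: "lin_ext (\<lambda>w. c *\<^sub>Q f w) p = c *\<^sub>Q lin_ext f p"
  by (simp add: lin_ext_def scaleQ_sum scaleQ_scaleQ mult.commute)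

lemma lin_ext_word_poly_id: "lin_ext word_poly p = p"
proof (rule poly_mapping_eqI)
  fix v
  have "Poly_Mapping.lookup (lin_ext word_poly p) v
      = (\<Sum>w\<in>Poly_Mapping.keys p. if w = v then Poly_Mapping.lookup p w else 0)"
    unfolding lin_ext_def lookup_sum
    by (intro sum.cong) (auto simp: lookup_scaleQ word_poly_def lookup_single scaleQ_rat_def when_def)
  also have "\<dots> = Poly_Mapping.lookup p v"
    by (auto simp: sum.delta in_keys_iff)
  finally show "Poly_Mapping.lookup (lin_ext word_poly p) v = Poly_Mapping.lookup p v" .
qed

text \<open>Noncommutative polynomials supported on \<open>S\<close> are spanned by the words in \<open>S\<close>.\<close>
lemma ncpoly_span_induct [consumes 1, case_names word zero add scale]:
  assumes "Poly_Mapping.keys p \<subseteq> S"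
    and word: "\<And>w. w \<in> S \<Longrightarrow> P (word_poly w)"
    and zero: "P 0"
    and add: "\<And>p q. P p \<Longrightarrow> P q \<Longrightarrow> P (p + q)"
    and scale: "\<And>c p. P p \<Longrightarrow> P (c *\<^sub>Q p)"
  shows "P p"
proof -
  have "P (\<Sum>w\<in>W. Poly_Mapping.lookup p w *\<^sub>Q word_poly w)" if "W \<subseteq> S" for W
    using that by (induction W rule: infinite_finite_induct) (auto intro: zero add scale word)
  from this[OF assms(1)] show ?thesis
    using lin_ext_word_poly_id[of p] by (simp add: lin_ext_def)
qed

lemma ncpoly_induct [case_names word add scale]:
  assumes word: "\<And>w. P (word_poly w)"
    and add: "\<And>p q. P p \<Longrightarrow> P q \<Longrightarrow> P (p + q)"
    and scale: "\<And>c p. P p \<Longrightarrow> P (c *\<^sub>Q p)"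
  shows "P p"
proof (rule ncpoly_span_induct[of p UNIV])
  show "P 0" using scale[OF word, of 0 "[]"] by simp
qed (simp_all add: assms)

lemma lookup_word_poly: "Poly_Mapping.lookup (word_poly v) w = (if v = w then 1 else 0)"
  by (simp add: word_poly_def lookup_single when_def)

lemma word_poly_Nil: "word_poly [] = 1"
  unfolding word_poly_def zero_list_def[symmetric] by simp

lemma word_poly_mult: "word_poly v * word_poly w = word_poly (v @ w)"
  by (simp add: word_poly_def mult_single plus_list_def)

lemma xx_mult_word: "xx u * word_poly w = word_poly (u # w)"
  by (simp add: xx_def word_poly_mult)

lemma scaleQ_conv_mult: "c *\<^sub>Q p = Poly_Mapping.single 0 c * p" for p :: "'g ncpoly"
  by (simp add: scaleQ_poly_mapping_def scaleQ_rat_def mult_map_scale_conv_mult)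

lemma single_zero_commute: "p * Poly_Mapping.single 0 c = Poly_Mapping.single 0 c * p"
  for p :: "'g ncpoly"
proof (induction p rule: ncpoly_induct)
  case (scale b p)
  have "(Poly_Mapping.single 0 b * p) * Poly_Mapping.single 0 c
      = (Poly_Mapping.single 0 b * Poly_Mapping.single 0 c) * p"
    using scale by (simp add: mult.assoc)
  also have "\<dots> = (Poly_Mapping.single 0 c * Poly_Mapping.single 0 b) * p"
    by (simp add: mult_single mult.commute)
  finally show ?case by (simp add: scaleQ_conv_mult mult.assoc)
qed (simp_all add: word_poly_def mult_single algebra_simps)

lemma ncpoly_scaleQ_mult_left: "(c *\<^sub>Q p) * q = c *\<^sub>Q (p * q)" for p :: "'g ncpoly"
  by (simp add: scaleQ_conv_mult mult.assoc)

lemma ncpoly_scaleQ_mult_right: "p * (c *\<^sub>Q q) = c *\<^sub>Q (p * q)" for p :: "'g ncpoly"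
  by (metis scaleQ_conv_mult mult.assoc single_zero_commute)

lemmas ncpoly_scaleQ_mult = ncpoly_scaleQ_mult_left ncpoly_scaleQ_mult_right


section \<open>The shuffle product\<close>

lemma sh_add_left: "sh (p + q) r = sh p r + sh q r"
  by (simp add: sh_def bilin_ext_def lin_ext_add)

lemma sh_add_right: "sh p (q + r) = sh p q + sh p r"
  by (simp add: sh_def bilin_ext_def lin_ext_add lin_ext_fun_add)

lemma sh_scaleQ_left: "sh (c *\<^sub>Q p) q = c *\<^sub>Q sh p q"
  by (simp add: sh_def bilin_ext_def lin_ext_scaleQ)

lemma sh_scaleQ_right: "sh p (c *\<^sub>Q q) = c *\<^sub>Q sh p q"
  by (simp add: sh_def bilin_ext_def lin_ext_scaleQ lin_ext_fun_scaleQ)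

lemma sh_zero [simp]: "sh 0 p = 0" "sh p 0 = 0"
  using sh_scaleQ_left[of 0 0 p] sh_scaleQ_right[of p 0 0] by simp_all

lemmas sh_bilinear = sh_add_left sh_add_right sh_scaleQ_left sh_scaleQ_right

lemma sh_word_poly: "sh (word_poly v) (word_poly w) = sh_word v w"
  by (simp add: sh_def bilin_ext_def)

lemma sh_word_Nil_right [simp]: "sh_word w [] = word_poly w"
  by (cases w) simp_all

lemma sh_one_left [simp]: "sh 1 p = p"
  by (induction p rule: ncpoly_induct)
     (simp_all add: sh_bilinear sh_word_poly flip: word_poly_Nil)

lemma sh_one_right [simp]: "sh p 1 = p"
  by (induction p rule: ncpoly_induct)
     (simp_all add: sh_bilinear sh_word_poly flip: word_poly_Nil)

text \<open>The recursion that defines the shuffle of words, extended bilinearly.\<close>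
lemma sh_xx_mult: "sh (xx u * p) (xx v * q) = xx u * sh p (xx v * q) + xx v * sh (xx u * p) q"
proof (induction p rule: ncpoly_induct)
  case (word w)
  show ?case
    by (induction q rule: ncpoly_induct)
       (simp_all add: sh_bilinear ncpoly_scaleQ_mult distrib_left scaleQ_add_right xx_mult_word
         sh_word_poly)
qed (simp_all add: sh_bilinear ncpoly_scaleQ_mult distrib_left scaleQ_add_right)

lemma sh_commute: "sh p q = sh q p"
proof -
  have *: "sh_word v w = sh_word w v" for v w :: "'a word"
    by (induction v w rule: sh_word.induct) (simp_all add: add.commute)
  show ?thesis
  proof (induction p rule: ncpoly_induct)
    case (word w)
    show ?case
      by (induction q rule: ncpoly_induct) (simp_all add: sh_bilinear sh_word_poly *[of w])
  qed (simp_all add: sh_bilinear)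
qed

lemma sh_assoc: "sh (sh p q) r = sh p (sh q r)"
proof -
  have *: "sh (sh (word_poly a) (word_poly b)) (word_poly c)
      = sh (word_poly a) (sh (word_poly b) (word_poly c))" for a b c :: "'a word"
  proof (induction "length a + length b + length c" arbitrary: a b c rule: less_induct)
    case less
    show ?case
    proof (cases "a = [] \<or> b = [] \<or> c = []")
      case True
      then show ?thesis by (auto simp: word_poly_Nil)
    next
      case False
      then obtain u a' v b' w c' where eq: "a = u # a'" "b = v # b'" "c = w # c'"
        by (meson neq_Nil_conv)
      let ?a = "word_poly a'" and ?b = "word_poly b'" and ?c = "word_poly c'"
      have IH1: "sh (sh ?a (xx v * ?b)) (xx w * ?c) = sh ?a (sh (xx v * ?b) (xx w * ?c))"
        using less[of a' b c] by (simp add: eq xx_mult_word)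
      have IH2: "sh (sh (xx u * ?a) ?b) (xx w * ?c) = sh (xx u * ?a) (sh ?b (xx w * ?c))"
        using less[of a b' c] by (simp add: eq xx_mult_word)
      have IH3: "sh (sh (xx u * ?a) (xx v * ?b)) ?c = sh (xx u * ?a) (sh (xx v * ?b) ?c)"
        using less[of a b c'] by (simp add: eq xx_mult_word)
      have L: "sh (sh (xx u * ?a) (xx v * ?b)) (xx w * ?c)
          = xx u * sh (sh ?a (xx v * ?b)) (xx w * ?c) + xx v * sh (sh (xx u * ?a) ?b) (xx w * ?c)
            + xx w * sh (sh (xx u * ?a) (xx v * ?b)) ?c"
        by (simp add: sh_xx_mult[of u ?a v ?b] sh_add_left sh_xx_mult[of _ _ w ?c]
            algebra_simps del: sh_word.simps)
      have R: "sh (xx u * ?a) (sh (xx v * ?b) (xx w * ?c))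
          = xx u * sh ?a (sh (xx v * ?b) (xx w * ?c)) + xx v * sh (xx u * ?a) (sh ?b (xx w * ?c))
            + xx w * sh (xx u * ?a) (sh (xx v * ?b) ?c)"
        by (simp add: sh_xx_mult[of v ?b w ?c] sh_add_right sh_xx_mult[of u ?a]
            algebra_simps)
      show ?thesis
        using L R IH1 IH2 IH3 by (simp add: eq xx_mult_word)
    qed
  qed
  show ?thesis
  proof (induction p rule: ncpoly_induct)
    case (word a)
    show ?case
    proof (induction q rule: ncpoly_induct)
      case (word b)
      show ?case
        by (induction r rule: ncpoly_induct) (simp_all add: sh_bilinear *)
    qed (simp_all add: sh_bilinear)
  qed (simp_all add: sh_bilinear)
qed


section \<open>Deletion of a leading or trailing letter\<close>

text \<open>The linear map that deletes a leading letter \<open>l\<close>; words that do not begin with \<open>l\<close> go to 0.\<close>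
definition ldel :: "'g option \<Rightarrow> 'g ncpoly \<Rightarrow> 'g ncpoly" where
  "ldel l = lin_ext (\<lambda>w. if w \<noteq> [] \<and> hd w = l then word_poly (tl w) else 0)"

text \<open>The linear map that deletes a trailing letter \<open>l\<close>; words that do not end with \<open>l\<close> go to 0.\<close>
definition rdel :: "'g option \<Rightarrow> 'g ncpoly \<Rightarrow> 'g ncpoly" where
  "rdel l = lin_ext (\<lambda>w. if w \<noteq> [] \<and> last w = l then word_poly (butlast w) else 0)"

lemma ldel_linear: "ldel l (p + q) = ldel l p + ldel l q" "ldel l (c *\<^sub>Q p) = c *\<^sub>Q ldel l p"
  "ldel l 0 = 0"
  by (simp_all add: ldel_def lin_ext_add lin_ext_scaleQ)

lemma rdel_linear: "rdel l (p + q) = rdel l p + rdel l q" "rdel l (c *\<^sub>Q p) = c *\<^sub>Q rdel l p"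
  "rdel l 0 = 0"
  by (simp_all add: rdel_def lin_ext_add lin_ext_scaleQ)

lemma ldel_word: "ldel l (word_poly w) = (if w \<noteq> [] \<and> hd w = l then word_poly (tl w) else 0)"
  by (simp add: ldel_def)

lemma rdel_word:
  "rdel l (word_poly w) = (if w \<noteq> [] \<and> last w = l then word_poly (butlast w) else 0)"
  by (simp add: rdel_def)

lemma ldel_one [simp]: "ldel l 1 = 0" and rdel_one [simp]: "rdel l 1 = 0"
  by (simp_all add: ldel_word rdel_word flip: word_poly_Nil)

lemma ldel_xx_mult: "ldel l (xx u * p) = (if u = l then p else 0)"
  by (induction p rule: ncpoly_induct)
     (simp_all add: ldel_linear ldel_word xx_mult_word distrib_left ncpoly_scaleQ_mult)

lemma rdel_mult_xx: "rdel l (p * xx u) = (if u = l then p else 0)"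
  by (induction p rule: ncpoly_induct)
     (simp_all add: rdel_linear rdel_word word_poly_mult xx_def distrib_right ncpoly_scaleQ_mult)

text \<open>
  The correction term comes from the constant term of \<open>p\<close>: in the word \<open>[u]\<close> the first letter is also
  the last one.
\<close>
lemma rdel_xx_mult:
  "rdel l (xx u * p) = xx u * rdel l p + (if u = l then Poly_Mapping.lookup p [] *\<^sub>Q 1 else 0)"
proof (induction p rule: ncpoly_induct)
  case (word w)
  then show ?case
    by (cases "w = []")
       (simp_all add: rdel_word xx_mult_word lookup_word_poly scaleQ_one flip: word_poly_Nil)
next
  case (scale c p)
  then show ?case
    by (simp add: rdel_linear ncpoly_scaleQ_mult lookup_scaleQ scaleQ_add_right scaleQ_scaleQ
        scaleQ_rat_def)
qed (simp_all add: rdel_linear distrib_left lookup_add scaleQ_add_left)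

lemma lookup_ldel: "Poly_Mapping.lookup (ldel l p) w = Poly_Mapping.lookup p (l # w)"
proof (induction p rule: ncpoly_induct)
  case (word v)
  then show ?case
    by (cases v) (auto simp: ldel_word lookup_word_poly)
qed (simp_all add: ldel_linear lookup_add lookup_scaleQ)

lemma lookup_rdel: "Poly_Mapping.lookup (rdel l p) w = Poly_Mapping.lookup p (w @ [l])"
proof (induction p rule: ncpoly_induct)
  case (word v)
  then show ?case
    by (cases v rule: rev_cases) (auto simp: rdel_word lookup_word_poly)
qed (simp_all add: rdel_linear lookup_add lookup_scaleQ)

lemma ldel_rdel_commute: "ldel l (rdel m p) = rdel m (ldel l p)"
  by (rule poly_mapping_eqI) (simp add: lookup_ldel lookup_rdel)

lemma ldel_sh: "ldel l (sh p q) = sh (ldel l p) q + sh p (ldel l q)"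
proof (induction p rule: ncpoly_induct)
  case (word v)
  show ?case
  proof (induction q rule: ncpoly_induct)
    case (word w)
    show ?case
    proof (cases v; cases w)
      fix a v' b w' assume "v = a # v'" "w = b # w'"
      then show ?thesis
        by (simp flip: xx_mult_word add: sh_xx_mult ldel_linear ldel_xx_mult)
    qed (simp_all add: word_poly_Nil)
  qed (simp_all add: sh_bilinear ldel_linear scaleQ_add_right)
qed (simp_all add: sh_bilinear ldel_linear scaleQ_add_right)

lemma lookup_xx_mult_Nil [simp]: "Poly_Mapping.lookup (xx u * p) [] = 0"
  by (induction p rule: ncpoly_induct)
     (simp_all add: distrib_left ncpoly_scaleQ_mult lookup_add lookup_scaleQ xx_mult_word
        lookup_word_poly)

lemma lookup_sh_xx_mult_Nil [simp]:
  "Poly_Mapping.lookup (sh p (xx u * q)) [] = 0" "Poly_Mapping.lookup (sh (xx u * q) p) [] = 0"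
proof -
  show *: "Poly_Mapping.lookup (sh p (xx u * q)) [] = 0"
  proof (induction p rule: ncpoly_induct)
    case (word v)
    then show ?case
      by (cases v) (simp_all add: word_poly_Nil sh_xx_mult lookup_add flip: xx_mult_word)
  qed (simp_all add: sh_bilinear lookup_add lookup_scaleQ)
  then show "Poly_Mapping.lookup (sh (xx u * q) p) [] = 0"
    by (simp add: sh_commute)
qed

text \<open>
  The shuffle product is defined by recursion on first letters. In the induction on the lengths of
  the words, the correction terms of \<open>rdel_xx_mult\<close> vanish at shuffles with nonempty words.
\<close>
lemma rdel_sh: "rdel l (sh p q) = sh (rdel l p) q + sh p (rdel l q)"
proof -
  have *: "rdel l (sh (word_poly v) (word_poly w))
      = sh (rdel l (word_poly v)) (word_poly w) + sh (word_poly v) (rdel l (word_poly w))" for v w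
  proof (induction "length v + length w" arbitrary: v w rule: less_induct)
    case less
    show ?case
    proof (cases v; cases w)
      fix a v' b w' assume eq: "v = a # v'" "w = b # w'"
      let ?p = "word_poly v'" and ?q = "word_poly w'"
      have IH1: "rdel l (sh ?p (xx b * ?q)) = sh (rdel l ?p) (xx b * ?q) + sh ?p (rdel l (xx b * ?q))"
        using less[of v' w] by (simp add: eq xx_mult_word)
      have IH2: "rdel l (sh (xx a * ?p) ?q) = sh (rdel l (xx a * ?p)) ?q + sh (xx a * ?p) (rdel l ?q)"
        using less[of v w'] by (simp add: eq xx_mult_word)
      show ?thesis
        unfolding eq xx_mult_word[symmetric] sh_xx_mult
        by (simp add: rdel_linear rdel_xx_mult[of l a "sh _ _"] rdel_xx_mult[of l b "sh _ _"] IH1 IH2)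
           (simp add: rdel_xx_mult sh_bilinear sh_xx_mult distrib_left ncpoly_scaleQ_mult)
    qed (simp_all add: word_poly_Nil)
  qed
  show ?thesis
  proof (induction p rule: ncpoly_induct)
    case (word v)
    show ?case
      by (induction q rule: ncpoly_induct)
         (simp_all add: sh_bilinear rdel_linear scaleQ_add_right *)
  qed (simp_all add: sh_bilinear rdel_linear scaleQ_add_right)
qed

section \<open>Locally nilpotent derivations\<close>

lemma map_poly_add_hom:
  assumes "h 0 = 0" "\<And>x y. h (x + y) = h x + h y"
  shows "map_poly h (p + q) = map_poly h p + map_poly h q"
  using assms by (intro poly_eqI) (simp add: coeff_map_poly)

lemma map_poly_mult_hom:
  fixes h :: "'a :: comm_ring_1 \<Rightarrow> 'b :: comm_ring_1"
  assumes "h 0 = 0" "\<And>x y. h (x + y) = h x + h y" "\<And>x y. h (x * y) = h x * h y"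
  shows "map_poly h (p * q) = map_poly h p * map_poly h q"
proof (rule poly_eqI)
  fix n
  have "h (\<Sum>i\<le>n. coeff p i * coeff q (n - i)) = (\<Sum>i\<le>n. h (coeff p i * coeff q (n - i)))"
    using sum_comp_morphism[of h "\<lambda>i. coeff p i * coeff q (n - i)" "{..n}"] assms(1,2)
    by (simp add: o_def)
  then show "coeff (map_poly h (p * q)) n = coeff (map_poly h p * map_poly h q) n"
    by (simp add: coeff_map_poly assms coeff_mult)
qed

lemma map_poly_as_sum:
  assumes "h 0 = 0"
  shows "map_poly h p = (\<Sum>i\<le>degree p. monom (h (coeff p i)) i)"
proof (rule poly_eqI)
  fix n
  have "coeff (\<Sum>i\<le>degree p. monom (h (coeff p i)) i) n
      = (\<Sum>i\<le>degree p. if i = n then h (coeff p i) else 0)"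
    by (simp add: coeff_sum)
  also have "\<dots> = h (coeff p n)"
    using assms by (auto simp: sum.delta coeff_eq_0)
  finally show "coeff (map_poly h p) n = coeff (\<Sum>i\<le>degree p. monom (h (coeff p i)) i) n"
    using assms by (simp add: coeff_map_poly)
qed

lemma poly_eval_closed:
  assumes "0 \<in> S" "\<And>x y. x \<in> S \<Longrightarrow> y \<in> S \<Longrightarrow> x + y \<in> S" "\<And>x y. x \<in> S \<Longrightarrow> y \<in> S \<Longrightarrow> x * y \<in> S"
    and "x \<in> S" "\<And>n. coeff p n \<in> S"
  shows "poly p x \<in> S"
  using assms(5)
proof (induction p)
  case (pCons a p)
  have "a \<in> S" "\<And>n. coeff p n \<in> S"
    using pCons.prems[of 0] pCons.prems[of "Suc _"] by simp_all
  then show ?case using pCons.IH assms by simp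
qed (simp add: assms)

text \<open>Derivations of a commutative rational algebra.\<close>
locale derivation =
  fixes D :: "'a :: comm_rat_algebra_1 \<Rightarrow> 'a"
  assumes add: "D (x + y) = D x + D y"
    and scaleQ: "D (c *\<^sub>Q x) = c *\<^sub>Q D x"
    and mult: "D (x * y) = D x * y + x * D y"
begin

lemma zero: "D 0 = 0"
  using scaleQ[of 0 0] by simp

lemma one: "D 1 = 0"
  using mult[of 1 1] by simp

lemma minus: "D (- x) = - D x"
  using add[of x "- x"] by (simp add: zero eq_neg_iff_add_eq_0 add.commute)

lemma sum: "D (\<Sum>i\<in>I. f i) = (\<Sum>i\<in>I. D (f i))"
  by (induction I rule: infinite_finite_induct) (simp_all add: zero add)

lemma map_poly_pCons_D: "map_poly D (pCons a p) = pCons (D a) (map_poly D p)"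
  by (intro map_poly_pCons zero)

text \<open>The chain rule; the polynomial \<open>q\<close> is the formal derivative of \<open>p\<close>.\<close>
lemma poly_eval:
  assumes "\<And>n. coeff q n = of_nat (Suc n) * coeff p (Suc n)"
  shows "D (poly p x) = poly (map_poly D p) x + D x * poly q x"
  using assms
proof (induction p arbitrary: q)
  case 0
  then have "q = 0" by (intro poly_eqI) simp
  then show ?case by (simp add: zero)
next
  case (pCons a p)
  define r where "r = poly_shift 1 (q - p)"
  have r: "coeff r n = of_nat (Suc n) * coeff p (Suc n)" for n
    by (simp add: r_def coeff_poly_shift pCons.prems algebra_simps)
  have "q = p + pCons 0 r"
    by (rule poly_eqI) (auto simp: coeff_pCons r pCons.prems algebra_simps split: nat.split)
  then show ?case
    by (simp add: add mult map_poly_pCons_D pCons.IH[OF r] algebra_simps)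
qed

lemma poly_eval_const: "D x = 0 \<Longrightarrow> D (poly p x) = poly (map_poly D p) x"
  by (induction p) (simp_all add: zero add mult map_poly_pCons_D)

text \<open>The divided power \<open>D\<^sup>n / n!\<close>.\<close>
definition divpow :: "nat \<Rightarrow> 'a \<Rightarrow> 'a" where
  "divpow n x = (1 / fact n) *\<^sub>Q (D ^^ n) x"

lemma divpow_0 [simp]: "divpow 0 x = x"
  by (simp add: divpow_def scaleQ_one)

lemma D_divpow: "D (divpow n x) = of_nat (Suc n) *\<^sub>Q divpow (Suc n) x"
proof -
  have "of_nat (Suc n) * (1 / fact (Suc n) :: rat) = 1 / fact n"
    by (simp add: field_simps del: of_nat_Suc)
  then show ?thesis by (simp only: divpow_def scaleQ scaleQ_scaleQ) simp
qed

lemma divpow_Suc: "divpow (Suc n) x = (1 / of_nat (Suc n)) *\<^sub>Q D (divpow n x)"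
  unfolding D_divpow scaleQ_scaleQ by (simp add: scaleQ_one del: of_nat_Suc)

lemma divpow_add: "divpow n (x + y) = divpow n x + divpow n y"
  by (induction n) (simp_all add: divpow_Suc add scaleQ_add_right del: of_nat_Suc)

lemma divpow_scaleQ: "divpow n (c *\<^sub>Q x) = c *\<^sub>Q divpow n x"
  by (induction n) (simp_all add: divpow_Suc scaleQ scaleQ_scaleQ mult.commute del: of_nat_Suc)

text \<open>The Leibniz rule for divided powers.\<close>
lemma divpow_mult: "divpow n (x * y) = (\<Sum>i\<le>n. divpow i x * divpow (n - i) y)"
proof (induction n)
  case (Suc n)
  define f where "f i = divpow i x * divpow (Suc n - i) y" for i
  have "of_nat (Suc n) *\<^sub>Q divpow (Suc n) (x * y) = D (\<Sum>i\<le>n. divpow i x * divpow (n - i) y)"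
    by (simp only: D_divpow[symmetric] Suc)
  also have "\<dots> = (\<Sum>i\<le>n. of_nat (Suc i) *\<^sub>Q f (Suc i)) + (\<Sum>i\<le>n. of_nat (Suc n - i) *\<^sub>Q f i)"
    by (simp add: sum mult D_divpow mult_scaleQ_left mult_scaleQ_right sum.distrib f_def Suc_diff_le
        del: of_nat_Suc)
  also have "(\<Sum>i\<le>n. of_nat (Suc i) *\<^sub>Q f (Suc i)) = (\<Sum>i\<le>Suc n. of_nat i *\<^sub>Q f i)"
    by (subst sum.atMost_Suc_shift) simp
  also have "(\<Sum>i\<le>n. of_nat (Suc n - i) *\<^sub>Q f i) = (\<Sum>i\<le>Suc n. of_nat (Suc n - i) *\<^sub>Q f i)"
    by simp
  also have "(\<Sum>i\<le>Suc n. of_nat i *\<^sub>Q f i) + (\<Sum>i\<le>Suc n. of_nat (Suc n - i) *\<^sub>Q f i)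
      = (\<Sum>i\<le>Suc n. of_nat (Suc n) *\<^sub>Q f i)"
    unfolding sum.distrib[symmetric]
  proof (intro sum.cong refl)
    fix i assume "i \<in> {..Suc n}"
    then have "(of_nat i + of_nat (Suc n - i) :: rat) = of_nat (Suc n)"
      by (metis atMost_iff le_add_diff_inverse of_nat_add)
    then show "of_nat i *\<^sub>Q f i + of_nat (Suc n - i) *\<^sub>Q f i = of_nat (Suc n) *\<^sub>Q f i"
      by (metis scaleQ_add_left)
  qed
  also have "\<dots> = of_nat (Suc n) *\<^sub>Q (\<Sum>i\<le>Suc n. f i)"
    by (simp only: scaleQ_sum)
  finally have "(1 / of_nat (Suc n)) *\<^sub>Q (of_nat (Suc n) *\<^sub>Q divpow (Suc n) (x * y))
      = (1 / of_nat (Suc n)) *\<^sub>Q (of_nat (Suc n) *\<^sub>Q (\<Sum>i\<le>Suc n. f i))"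
    by (rule arg_cong)
  then show ?case
    unfolding scaleQ_scaleQ f_def by (simp add: scaleQ_one del: of_nat_Suc)
qed simp

end

text \<open>Every element is annihilated by some power of \<open>D\<close>, which depends on the element.\<close>
locale locally_nilpotent_derivation = derivation D
  for D :: "'a :: comm_rat_algebra_1 \<Rightarrow> 'a" +
  assumes nilpotent: "\<exists>n. (D ^^ n) x = 0"
begin

text \<open>
  The Taylor map \<open>exp (T D)\<close>, with \<open>divpow n x\<close> as coefficient of index \<open>n\<close>. It has values in
  polynomials, not only in power series, because \<open>D\<close> is locally nilpotent.
\<close>
definition taylor :: "'a \<Rightarrow> 'a poly" where
  "taylor x = Abs_poly (\<lambda>n. divpow n x)"

lemma coeff_taylor: "coeff (taylor x) n = divpow n x"
proof -
  obtain N where N: "(D ^^ N) x = 0"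
    using nilpotent by blast
  have *: "divpow n x = 0" if "n > N" for n
  proof -
    have "(D ^^ m) 0 = 0" for m
      by (induction m) (simp_all add: zero)
    then have "(D ^^ (n - N + N)) x = 0"
      by (simp only: funpow_add o_apply N)
    with that show ?thesis
      by (simp add: divpow_def)
  qed
  then show ?thesis
    unfolding taylor_def using coeff_Abs_poly[of N "\<lambda>n. divpow n x", OF *] by simp
qed

lemma taylor_add: "taylor (x + y) = taylor x + taylor y"
  by (rule poly_eqI) (simp add: coeff_taylor divpow_add)

lemma taylor_scaleQ: "taylor (c *\<^sub>Q x) = c *\<^sub>Q taylor x"
  by (rule poly_eqI) (simp add: coeff_taylor divpow_scaleQ coeff_scaleQ)

lemma taylor_mult: "taylor (x * y) = taylor x * taylor y"
  by (rule poly_eqI) (simp add: coeff_taylor divpow_mult coeff_mult)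

lemma taylor_const: "D x = 0 \<Longrightarrow> taylor x = [:x:]"
proof (rule poly_eqI)
  fix n assume "D x = 0"
  then have "divpow (Suc m) x = 0" for m
    by (induction m) (simp_all add: divpow_Suc zero del: of_nat_Suc)
  then show "coeff (taylor x) n = coeff [:x:] n"
    by (cases n) (simp_all add: coeff_taylor)
qed

lemma coeff_map_poly_D_taylor:
  "coeff (map_poly D (taylor x)) n = of_nat (Suc n) * coeff (taylor x) (Suc n)"
  by (simp add: coeff_map_poly zero coeff_taylor D_divpow of_nat_scaleQ del: of_nat_Suc)

end

text \<open>
  An element \<open>s\<close> with \<open>D s = 1\<close>, called a slice, identifies the algebra with the polynomials in \<open>s\<close>
  over the kernel of \<open>D\<close>.
\<close>
locale derivation_with_slice = locally_nilpotent_derivation D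
  for D :: "'a :: comm_rat_algebra_1 \<Rightarrow> 'a" +
  fixes s :: 'a
  assumes slice: "D s = 1"
begin

lemma taylor_slice: "taylor s = [:s, 1:]"
proof (rule poly_eqI)
  fix n
  have "divpow (Suc (Suc m)) s = 0" for m
    by (induction m) (simp_all add: divpow_Suc zero slice one scaleQ scaleQ_one del: of_nat_Suc)
  moreover have "divpow (Suc 0) s = 1"
    by (simp add: divpow_Suc slice scaleQ_one)
  ultimately show "coeff (taylor s) n = coeff [:s, 1:] n"
    by (simp add: coeff_taylor coeff_pCons split: nat.split)
qed

text \<open>The map \<open>exp (- s D)\<close>, an algebra homomorphism that projects onto the kernel of \<open>D\<close> and kills \<open>s\<close>.\<close>
definition proj :: "'a \<Rightarrow> 'a" where
  "proj x = poly (taylor x) (- s)"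

lemma proj_add: "proj (x + y) = proj x + proj y"
  by (simp add: proj_def taylor_add)

lemma proj_mult: "proj (x * y) = proj x * proj y"
  by (simp add: proj_def taylor_mult)

lemma poly_scaleQ: "poly (c *\<^sub>Q p) x = c *\<^sub>Q poly p x" for x :: 'a
proof -
  have "c *\<^sub>Q p = smult (c *\<^sub>Q 1) p"
    by (rule poly_eqI) (simp add: coeff_scaleQ mult_scaleQ_left)
  then show ?thesis by (simp add: mult_scaleQ_left)
qed

lemma proj_scaleQ: "proj (c *\<^sub>Q x) = c *\<^sub>Q proj x"
  by (simp add: proj_def taylor_scaleQ poly_scaleQ)

lemma proj_const: "D x = 0 \<Longrightarrow> proj x = x"
  by (simp add: proj_def taylor_const)

lemma proj_slice: "proj s = 0"
  by (simp add: proj_def taylor_slice)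

text \<open>
  Differentiating \<open>\<Sum>n. divpow n x * (- s)\<^sup>n\<close> gives a telescoping sum, since \<open>D s = 1\<close> and
  \<open>D (divpow n x) = (n + 1) divpow (n + 1) x\<close>.
\<close>
lemma D_proj: "D (proj x) = 0"
  by (simp add: proj_def poly_eval[OF coeff_map_poly_D_taylor] minus slice)

lemma proj_zero [simp]: "proj 0 = 0" and proj_one [simp]: "proj 1 = 1"
  by (simp_all add: proj_const zero one)

lemma proj_commuting_derivation:
  assumes "derivation E" "\<And>x. E (D x) = D (E x)" "E s = 0" "E x = 0"
  shows "E (proj x) = 0"
proof -
  interpret E: derivation E by fact
  have "E (divpow n x) = 0" for n
    by (induction n) (simp_all add: assms divpow_Suc E.scaleQ zero del: of_nat_Suc)
  then have "map_poly E (taylor x) = 0"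
    by (intro poly_eqI) (simp add: coeff_map_poly E.zero coeff_taylor)
  then show ?thesis
    by (simp add: proj_def E.poly_eval_const E.minus assms)
qed

lemma divpow_closed:
  assumes "\<And>x. x \<in> S \<Longrightarrow> D x \<in> S" "\<And>c x. x \<in> S \<Longrightarrow> c *\<^sub>Q x \<in> S" "x \<in> S"
  shows "divpow n x \<in> S"
  using assms by (induction n) (simp_all add: divpow_Suc del: of_nat_Suc)

lemma proj_closed:
  assumes "\<And>x y. x \<in> S \<Longrightarrow> y \<in> S \<Longrightarrow> x + y \<in> S" "\<And>x y. x \<in> S \<Longrightarrow> y \<in> S \<Longrightarrow> x * y \<in> S"
    and "\<And>x. x \<in> S \<Longrightarrow> D x \<in> S" "\<And>c x. x \<in> S \<Longrightarrow> c *\<^sub>Q x \<in> S" "s \<in> S" "x \<in> S"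
  shows "proj x \<in> S"
  unfolding proj_def
proof (rule poly_eval_closed)
  show "0 \<in> S" using assms(4)[OF assms(5), of 0] by simp
  show "- s \<in> S" using assms(4)[OF assms(5), of "- 1"] by (simp add: scaleQ_minus_left scaleQ_one)
qed (use assms in \<open>auto simp: coeff_taylor intro: divpow_closed\<close>)

text \<open>
  The expansion of \<open>x\<close> in powers of the slice \<open>s\<close>, with coefficients in the kernel of \<open>D\<close> and with
  the variable \<open>T\<close> in place of \<open>s\<close>. This is \<open>exp ((T - s) D)\<close>.
\<close>
definition proj_taylor :: "'a \<Rightarrow> 'a poly" where
  "proj_taylor x = map_poly proj (taylor x)"

lemma coeff_proj_taylor: "coeff (proj_taylor x) n = proj (divpow n x)"
  by (simp add: proj_taylor_def coeff_map_poly coeff_taylor)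

lemma proj_taylor_add: "proj_taylor (x + y) = proj_taylor x + proj_taylor y"
  by (simp add: proj_taylor_def taylor_add map_poly_add_hom proj_add)

lemma proj_taylor_mult: "proj_taylor (x * y) = proj_taylor x * proj_taylor y"
  by (simp add: proj_taylor_def taylor_mult map_poly_mult_hom proj_add proj_mult)

lemma proj_taylor_const: "D x = 0 \<Longrightarrow> proj_taylor x = [:x:]"
  by (simp add: proj_taylor_def taylor_const map_poly_pCons proj_const)

lemma proj_taylor_slice: "proj_taylor s = [:0, 1:]"
  by (simp add: proj_taylor_def taylor_slice map_poly_pCons proj_slice)

end

section \<open>The shuffle algebra as a commutative algebra\<close>

text \<open>
  A copy of the noncommutative polynomials that carries the shuffle product as its multiplication, so
  that the theory of derivations of commutative algebras applies.
\<close>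
typedef 'g shuffle = "UNIV :: 'g ncpoly set"
  morphisms ncpoly_of shuffle_of
  by simp

setup_lifting type_definition_shuffle

instantiation shuffle :: (type) comm_rat_algebra_1
begin

lift_definition zero_shuffle :: "'a shuffle" is 0 .
lift_definition one_shuffle :: "'a shuffle" is 1 .
lift_definition plus_shuffle :: "'a shuffle \<Rightarrow> 'a shuffle \<Rightarrow> 'a shuffle" is "(+)" .
lift_definition minus_shuffle :: "'a shuffle \<Rightarrow> 'a shuffle \<Rightarrow> 'a shuffle" is "(-)" .
lift_definition uminus_shuffle :: "'a shuffle \<Rightarrow> 'a shuffle" is uminus .
lift_definition times_shuffle :: "'a shuffle \<Rightarrow> 'a shuffle \<Rightarrow> 'a shuffle" is sh .
lift_definition scaleQ_shuffle :: "rat \<Rightarrow> 'a shuffle \<Rightarrow> 'a shuffle" is scaleQ .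

instance
proof
  fix a b c :: "'a shuffle"
  show "a * b = b * a" by transfer (rule sh_commute)
  show "a * b * c = a * (b * c)" by transfer (rule sh_assoc)
qed (transfer; simp add: sh_bilinear scaleQ_add_right scaleQ_add_left scaleQ_scaleQ scaleQ_one)+

end

text \<open>The two deletion maps and the letters, viewed in the shuffle algebra.\<close>
lift_definition ldel_shuffle :: "'g option \<Rightarrow> 'g shuffle \<Rightarrow> 'g shuffle" is ldel .
lift_definition rdel_shuffle :: "'g option \<Rightarrow> 'g shuffle \<Rightarrow> 'g shuffle" is rdel .
lift_definition letter :: "'g option \<Rightarrow> 'g shuffle" is xx .

lemma keys_length_bound: "\<exists>N. \<forall>w. N \<le> length w \<longrightarrow> Poly_Mapping.lookup p w = 0" for p :: "'g ncpoly"
proof -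
  have "length w < Suc (Max (length ` Poly_Mapping.keys p))"
    if "Poly_Mapping.lookup p w \<noteq> 0" for w
    using that by (intro le_imp_less_Suc Max_ge) (auto simp: in_keys_iff)
  then show ?thesis by (meson linorder_not_less)
qed

lemma ldel_xx: "ldel l (xx u) = (if u = l then 1 else 0)"
  using ldel_xx_mult[of l u 1] by simp

lemma rdel_xx: "rdel l (xx u) = (if u = l then 1 else 0)"
  using rdel_mult_xx[of l 1 u] by simp

text \<open>A word of length less than \<open>n\<close> has no \<open>n\<close> letters to delete.\<close>
lemma ldel_nilpotent: "\<exists>n. (ldel l ^^ n) p = 0"
proof -
  have "Poly_Mapping.lookup ((ldel l ^^ n) p) w = Poly_Mapping.lookup p (replicate n l @ w)" for n w
    by (induction n arbitrary: w) (simp_all add: lookup_ldel replicate_app_Cons_same)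
  moreover obtain N where "\<forall>w. N \<le> length w \<longrightarrow> Poly_Mapping.lookup p w = 0"
    using keys_length_bound by blast
  ultimately have "(ldel l ^^ N) p = 0"
    by (intro poly_mapping_eqI) simp
  then show ?thesis ..
qed

lemma rdel_nilpotent: "\<exists>n. (rdel l ^^ n) p = 0"
proof -
  have "Poly_Mapping.lookup ((rdel l ^^ n) p) w = Poly_Mapping.lookup p (w @ replicate n l)" for n w
    by (induction n arbitrary: w) (simp_all add: lookup_rdel)
  moreover obtain N where "\<forall>w. N \<le> length w \<longrightarrow> Poly_Mapping.lookup p w = 0"
    using keys_length_bound by blast
  ultimately have "(rdel l ^^ N) p = 0"
    by (intro poly_mapping_eqI) simp
  then show ?thesis ..
qed

lemma ncpoly_of_funpow_ldel: "ncpoly_of ((ldel_shuffle l ^^ n) x) = (ldel l ^^ n) (ncpoly_of x)"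
  by (induction n) (simp_all add: ldel_shuffle.rep_eq)

lemma ncpoly_of_funpow_rdel: "ncpoly_of ((rdel_shuffle l ^^ n) x) = (rdel l ^^ n) (ncpoly_of x)"
  by (induction n) (simp_all add: rdel_shuffle.rep_eq)

text \<open>
  Both deletions of the letter \<open>l\<close> are locally nilpotent derivations with the letter itself as a slice.
\<close>
interpretation leading: derivation_with_slice "ldel_shuffle l" "letter l" for l :: "'g option"
proof
  fix x :: "'g shuffle"
  show "\<exists>n. (ldel_shuffle l ^^ n) x = 0"
    using ldel_nilpotent[of l "ncpoly_of x"]
    by (simp add: ncpoly_of_inject[symmetric] ncpoly_of_funpow_ldel zero_shuffle.rep_eq)
qed (transfer; simp add: ldel_linear ldel_sh ldel_xx)+

interpretation trailing: derivation_with_slice "rdel_shuffle l" "letter l" for l :: "'g option"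
proof
  fix x :: "'g shuffle"
  show "\<exists>n. (rdel_shuffle l ^^ n) x = 0"
    using rdel_nilpotent[of l "ncpoly_of x"]
    by (simp add: ncpoly_of_inject[symmetric] ncpoly_of_funpow_rdel zero_shuffle.rep_eq)
qed (transfer; simp add: rdel_linear rdel_sh rdel_xx)+

section \<open>The subspaces of words over the letters of G\<close>

lemma HG_conv: "p \<in> HG G \<longleftrightarrow> (\<forall>w. Poly_Mapping.lookup p w \<noteq> 0 \<longrightarrow> set w \<subseteq> letters G)"
  by (auto simp: HG_def in_keys_iff subset_eq lists_eq_set)

lemma HG_add: "p \<in> HG G \<Longrightarrow> q \<in> HG G \<Longrightarrow> p + q \<in> HG G"
  using keys_add[of p q] unfolding HG_def by blast

lemma HG_scaleQ: "p \<in> HG G \<Longrightarrow> c *\<^sub>Q p \<in> HG G"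
  unfolding HG_conv lookup_scaleQ by (metis scaleQ_zero_right)

lemma HG_word: "word_poly w \<in> HG G \<longleftrightarrow> set w \<subseteq> letters G"
  by (auto simp: HG_def word_poly_def in_lists_conv_set)

lemma HG_zero [simp]: "0 \<in> HG G" and HG_one [simp]: "1 \<in> HG G"
  using HG_word[of "[]" G] by (simp_all add: HG_def word_poly_Nil)

lemma HG_xx: "xx l \<in> HG G \<longleftrightarrow> l \<in> letters G"
  by (simp add: xx_def HG_word)

lemma HG_sum: "(\<And>i. i \<in> I \<Longrightarrow> f i \<in> HG G) \<Longrightarrow> (\<Sum>i\<in>I. f i) \<in> HG G"
  by (induction I rule: infinite_finite_induct) (simp_all add: HG_add)

lemma HG_mult:
  assumes "p \<in> HG G" "q \<in> HG G"
  shows "p * q \<in> HG G"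
proof -
  have "x \<in> lists (letters G)" if x: "x \<in> Poly_Mapping.keys (p * q)" for x
  proof -
    obtain v w where vw: "x = v @ w" "v \<in> Poly_Mapping.keys p" "w \<in> Poly_Mapping.keys q"
      using subsetD[OF keys_mult x] unfolding plus_list_def by blast
    then have "v \<in> lists (letters G)" "w \<in> lists (letters G)"
      using assms by (auto simp: HG_def)
    then show ?thesis by (simp add: vw(1))
  qed
  then show ?thesis by (auto simp: HG_def)
qed

lemma HG_induct [consumes 1, case_names word add scale]:
  assumes "p \<in> HG G"
    and "\<And>w. set w \<subseteq> letters G \<Longrightarrow> P (word_poly w)"
    and "\<And>p q. P p \<Longrightarrow> P q \<Longrightarrow> P (p + q)"
    and "\<And>c p. P p \<Longrightarrow> P (c *\<^sub>Q p)"
  shows "P p"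
proof (rule ncpoly_span_induct[of p "lists (letters G)"])
  show "Poly_Mapping.keys p \<subseteq> lists (letters G)" using assms(1) by (simp add: HG_def)
  show "P 0" using assms(4)[OF assms(2), of "[]" 0] by simp
  show "P (word_poly w)" if "w \<in> lists (letters G)" for w
    using that by (intro assms(2)) (simp add: lists_eq_set)
qed (fact assms(3,4))+

lemma HG_sh:
  assumes "p \<in> HG G" "q \<in> HG G"
  shows "sh p q \<in> HG G"
proof -
  have *: "sh_word v w \<in> HG G" if "set v \<subseteq> letters G" "set w \<subseteq> letters G" for v w
    using that by (induction v w rule: sh_word.induct) (simp_all add: HG_word HG_add HG_mult HG_xx)
  show ?thesis
    using assms(1)
  proof (induction rule: HG_induct)
    case (word v)
    show ?case
      using assms(2) word
      by (induction rule: HG_induct) (simp_all add: sh_bilinear sh_word_poly * HG_add HG_scaleQ)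
  qed (simp_all add: sh_bilinear HG_add HG_scaleQ)
qed

lemma HG_ldel: "p \<in> HG G \<Longrightarrow> ldel l p \<in> HG G"
  by (induction rule: HG_induct)
     (auto simp: ldel_linear HG_add HG_scaleQ ldel_word HG_word dest: list.set_sel(2))

lemma HG_rdel: "p \<in> HG G \<Longrightarrow> rdel l p \<in> HG G"
  by (induction rule: HG_induct)
     (auto simp: rdel_linear HG_add HG_scaleQ rdel_word HG_word dest: in_set_butlastD)

lemma rdel_sum: "rdel l (\<Sum>i\<in>I. f i) = (\<Sum>i\<in>I. rdel l (f i))"
  by (simp add: rdel_def lin_ext_sum)

lemma ldel_sum: "ldel l (\<Sum>i\<in>I. f i) = (\<Sum>i\<in>I. ldel l (f i))"
  by (simp add: ldel_def lin_ext_sum)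

lemma HG1I:
  "(\<And>g. g \<in> carrier G \<Longrightarrow> a g \<in> HG G) \<Longrightarrow> p = c *\<^sub>Q 1 + (\<Sum>g\<in>carrier G. a g * xx (Some g))
    \<Longrightarrow> p \<in> HG1 G"
  unfolding HG1_def by blast

lemma HG1E:
  assumes "p \<in> HG1 G"
  obtains c a where "p = c *\<^sub>Q 1 + (\<Sum>g\<in>carrier G. a g * xx (Some g))"
    "\<And>g. g \<in> carrier G \<Longrightarrow> a g \<in> HG G"
  using assms unfolding HG1_def by blast

lemma HG1_subset:
  assumes "p \<in> HG1 G"
  shows "p \<in> HG G" "rdel None p = 0"
proof -
  obtain c a where p: "p = c *\<^sub>Q 1 + (\<Sum>g\<in>carrier G. a g * xx (Some g))"
    and a: "\<And>g. g \<in> carrier G \<Longrightarrow> a g \<in> HG G"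
    using assms by (rule HG1E) blast
  show "p \<in> HG G"
    unfolding p by (intro HG_add HG_scaleQ HG_sum HG_mult a) (auto simp: HG_xx letters_def)
  show "rdel None p = 0"
    by (simp add: p rdel_linear rdel_sum rdel_mult_xx)
qed

lemma HG1_zero: "0 \<in> HG1 G"
  by (rule HG1I[of G "\<lambda>_. 0" _ 0]) simp_all

lemma HG1_word:
  assumes "finite (carrier G)" "set w \<subseteq> letters G" "w = [] \<or> last w \<noteq> None"
  shows "word_poly w \<in> HG1 G"
proof (cases w rule: rev_cases)
  case Nil
  show ?thesis
    by (rule HG1I[of G "\<lambda>_. 0" _ 1]) (simp_all add: Nil word_poly_Nil scaleQ_one)
next
  case (snoc v l)
  then obtain h where h: "l = Some h" "h \<in> carrier G" and v: "set v \<subseteq> letters G"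
    using assms by (auto simp: letters_def)
  let ?a = "\<lambda>g. if g = h then word_poly v else 0"
  have "(\<Sum>g\<in>carrier G. ?a g * xx (Some g))
      = (\<Sum>g\<in>carrier G. if g = h then word_poly v * xx (Some h) else 0)"
    by (intro sum.cong) auto
  then show ?thesis
    using h v assms(1)
    by (intro HG1I[of G ?a _ 0]) (simp_all add: snoc xx_def word_poly_mult HG_word)
qed

lemma HG1_add: "p \<in> HG1 G \<Longrightarrow> q \<in> HG1 G \<Longrightarrow> p + q \<in> HG1 G"
proof (elim HG1E)
  fix c a c' a'
  assume p: "p = c *\<^sub>Q 1 + (\<Sum>g\<in>carrier G. a g * xx (Some g))"
      "\<And>g. g \<in> carrier G \<Longrightarrow> a g \<in> HG G"
    and q: "q = c' *\<^sub>Q 1 + (\<Sum>g\<in>carrier G. a' g * xx (Some g))"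
      "\<And>g. g \<in> carrier G \<Longrightarrow> a' g \<in> HG G"
  show "p + q \<in> HG1 G"
    by (rule HG1I[of G "\<lambda>g. a g + a' g" _ "c + c'"])
       (simp_all add: p q HG_add scaleQ_add_left sum.distrib distrib_right)
qed

lemma HG1_scaleQ: "p \<in> HG1 G \<Longrightarrow> k *\<^sub>Q p \<in> HG1 G"
proof (elim HG1E)
  fix c a
  assume p: "p = c *\<^sub>Q 1 + (\<Sum>g\<in>carrier G. a g * xx (Some g))"
      "\<And>g. g \<in> carrier G \<Longrightarrow> a g \<in> HG G"
  show "k *\<^sub>Q p \<in> HG1 G"
    by (rule HG1I[of G "\<lambda>g. k *\<^sub>Q a g" _ "k * c"])
       (simp_all add: p HG_scaleQ scaleQ_add_right scaleQ_scaleQ scaleQ_sum ncpoly_scaleQ_mult)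
qed

lemma HG0I:
  "(\<And>g. g \<in> carrier G \<Longrightarrow> a g \<in> HG G) \<Longrightarrow> (\<And>g. g \<in> carrier G - {\<one>\<^bsub>G\<^esub>} \<Longrightarrow> b g \<in> HG1 G)
   \<Longrightarrow> p = c *\<^sub>Q 1 + (\<Sum>g\<in>carrier G. xx None * a g * xx (Some g))
             + (\<Sum>g\<in>carrier G - {\<one>\<^bsub>G\<^esub>}. xx (Some g) * b g) \<Longrightarrow> p \<in> HG0 G"
  unfolding HG0_def by blast

lemma HG0E:
  assumes "p \<in> HG0 G"
  obtains c a b where "p = c *\<^sub>Q 1 + (\<Sum>g\<in>carrier G. xx None * a g * xx (Some g))
             + (\<Sum>g\<in>carrier G - {\<one>\<^bsub>G\<^esub>}. xx (Some g) * b g)"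
    "\<And>g. g \<in> carrier G \<Longrightarrow> a g \<in> HG G" "\<And>g. g \<in> carrier G - {\<one>\<^bsub>G\<^esub>} \<Longrightarrow> b g \<in> HG1 G"
  using assms unfolding HG0_def by blast

lemma HG0_add: "p \<in> HG0 G \<Longrightarrow> q \<in> HG0 G \<Longrightarrow> p + q \<in> HG0 G"
proof (elim HG0E)
  fix c a b c' a' b'
  assume p: "p = c *\<^sub>Q 1 + (\<Sum>g\<in>carrier G. xx None * a g * xx (Some g))
      + (\<Sum>g\<in>carrier G - {\<one>\<^bsub>G\<^esub>}. xx (Some g) * b g)"
      "\<And>g. g \<in> carrier G \<Longrightarrow> a g \<in> HG G" "\<And>g. g \<in> carrier G - {\<one>\<^bsub>G\<^esub>} \<Longrightarrow> b g \<in> HG1 G"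
    and q: "q = c' *\<^sub>Q 1 + (\<Sum>g\<in>carrier G. xx None * a' g * xx (Some g))
      + (\<Sum>g\<in>carrier G - {\<one>\<^bsub>G\<^esub>}. xx (Some g) * b' g)"
      "\<And>g. g \<in> carrier G \<Longrightarrow> a' g \<in> HG G" "\<And>g. g \<in> carrier G - {\<one>\<^bsub>G\<^esub>} \<Longrightarrow> b' g \<in> HG1 G"
  show "p + q \<in> HG0 G"
    by (rule HG0I[of G "\<lambda>g. a g + a' g" "\<lambda>g. b g + b' g" _ "c + c'"])
       (simp_all add: p q HG_add HG1_add scaleQ_add_left sum.distrib distrib_left distrib_right)
qed

lemma HG0_scaleQ: "p \<in> HG0 G \<Longrightarrow> k *\<^sub>Q p \<in> HG0 G"
proof (elim HG0E)
  fix c a b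
  assume p: "p = c *\<^sub>Q 1 + (\<Sum>g\<in>carrier G. xx None * a g * xx (Some g))
      + (\<Sum>g\<in>carrier G - {\<one>\<^bsub>G\<^esub>}. xx (Some g) * b g)"
      "\<And>g. g \<in> carrier G \<Longrightarrow> a g \<in> HG G" "\<And>g. g \<in> carrier G - {\<one>\<^bsub>G\<^esub>} \<Longrightarrow> b g \<in> HG1 G"
  show "k *\<^sub>Q p \<in> HG0 G"
    by (rule HG0I[of G "\<lambda>g. k *\<^sub>Q a g" "\<lambda>g. k *\<^sub>Q b g" _ "k * c"])
       (simp_all add: p HG_scaleQ HG1_scaleQ scaleQ_add_right scaleQ_scaleQ scaleQ_sum
         ncpoly_scaleQ_mult)
qed

lemma HG0_word:
  assumes "finite (carrier G)" "set w \<subseteq> letters G"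
    and "w \<noteq> [] \<Longrightarrow> hd w \<noteq> Some \<one>\<^bsub>G\<^esub> \<and> last w \<noteq> None"
  shows "word_poly w \<in> HG0 G"
proof (cases w)
  case Nil
  show ?thesis
    by (rule HG0I[of G "\<lambda>_. 0" "\<lambda>_. 0" _ 1]) (simp_all add: Nil word_poly_Nil HG1_zero scaleQ_one)
next
  case (Cons l v)
  show ?thesis
  proof (cases l)
    case None
    with Cons assms(3) have "v \<noteq> []" by auto
    then obtain v' m where v: "v = v' @ [m]" by (metis rev_exhaust)
    with assms Cons obtain h where h: "m = Some h" "h \<in> carrier G"
      by (auto simp: letters_def)
    have "(\<Sum>g\<in>carrier G. xx None * (if g = h then word_poly v' else 0) * xx (Some g))
      = (\<Sum>g\<in>carrier G. if g = h then xx None * word_poly v' * xx (Some h) else 0)"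
      by (intro sum.cong) auto
    then show ?thesis
      using assms h
      by (intro HG0I[of G "\<lambda>g. if g = h then word_poly v' else 0" "\<lambda>_. 0" _ 0])
         (simp_all add: Cons v None xx_def word_poly_mult HG_word HG1_zero)
  next
    case (Some h)
    then have h: "h \<in> carrier G - {\<one>\<^bsub>G\<^esub>}"
      using Cons assms(2,3) by (auto simp: letters_def)
    have "word_poly v \<in> HG1 G"
      using assms Cons by (intro HG1_word) (auto split: if_splits)
    moreover have "(\<Sum>g\<in>carrier G - {\<one>\<^bsub>G\<^esub>}. xx (Some g) * (if g = h then word_poly v else 0))
      = (\<Sum>g\<in>carrier G - {\<one>\<^bsub>G\<^esub>}. if g = h then xx (Some h) * word_poly v else 0)"
      by (intro sum.cong) auto
    ultimately show ?thesis
      using assms(1) h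
      by (intro HG0I[of G "\<lambda>_. 0" "\<lambda>g. if g = h then word_poly v else 0" _ 0])
         (simp_all add: Cons Some xx_def word_poly_mult HG1_zero)
  qed
qed

text \<open>
  The admissible subspace is cut out by the kernels of the two derivations: the words that occur
  neither begin with \<open>x\<^sub>1\<close> nor end with \<open>x\<^sub>0\<close>.
\<close>
lemma HG0_iff:
  assumes "finite (carrier G)"
  shows "p \<in> HG0 G \<longleftrightarrow> p \<in> HG G \<and> ldel (Some \<one>\<^bsub>G\<^esub>) p = 0 \<and> rdel None p = 0"
proof
  assume "p \<in> HG0 G"
  then obtain c a b where p: "p = c *\<^sub>Q 1 + (\<Sum>g\<in>carrier G. xx None * a g * xx (Some g))
             + (\<Sum>g\<in>carrier G - {\<one>\<^bsub>G\<^esub>}. xx (Some g) * b g)"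
    and a: "\<And>g. g \<in> carrier G \<Longrightarrow> a g \<in> HG G"
    and b: "\<And>g. g \<in> carrier G - {\<one>\<^bsub>G\<^esub>} \<Longrightarrow> b g \<in> HG1 G"
    by (rule HG0E) blast
  have b': "b g \<in> HG G" "rdel None (b g) = 0" if "g \<in> carrier G - {\<one>\<^bsub>G\<^esub>}" for g
    using HG1_subset[OF b[OF that]] by simp_all
  have "p \<in> HG G"
    unfolding p by (intro HG_add HG_scaleQ HG_sum HG_mult a b' HG_one) (auto simp: HG_xx letters_def)
  moreover have "ldel (Some \<one>\<^bsub>G\<^esub>) p = 0"
    by (simp add: p ldel_linear ldel_sum ldel_xx_mult mult.assoc)
  moreover have "rdel None p = 0"
    by (simp add: p rdel_linear rdel_sum rdel_mult_xx rdel_xx_mult b')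
  ultimately show "p \<in> HG G \<and> ldel (Some \<one>\<^bsub>G\<^esub>) p = 0 \<and> rdel None p = 0" by simp
next
  assume *: "p \<in> HG G \<and> ldel (Some \<one>\<^bsub>G\<^esub>) p = 0 \<and> rdel None p = 0"
  show "p \<in> HG0 G"
  proof (rule ncpoly_span_induct[of p "Poly_Mapping.keys p"])
    fix w assume w: "w \<in> Poly_Mapping.keys p"
    show "word_poly w \<in> HG0 G"
    proof (rule HG0_word[OF assms])
      show "set w \<subseteq> letters G" using * w by (auto simp: HG_conv in_keys_iff)
      assume "w \<noteq> []"
      moreover have "w \<noteq> Some \<one>\<^bsub>G\<^esub> # v" "w \<noteq> v @ [None]" for v
        using * w lookup_ldel[of "Some \<one>\<^bsub>G\<^esub>" p v] lookup_rdel[of None p v]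
        by (auto simp: in_keys_iff)
      ultimately show "hd w \<noteq> Some \<one>\<^bsub>G\<^esub> \<and> last w \<noteq> None"
        by (metis append_butlast_last_id list.collapse)
    qed
  next
    show "0 \<in> HG0 G" by (rule HG0I[of G "\<lambda>_. 0" "\<lambda>_. 0" _ 0]) (simp_all add: HG1_zero)
  qed (simp_all add: HG0_add HG0_scaleQ)
qed

section \<open>Existence of the shuffle regularization\<close>

lemma map_poly_ncpoly_of_mult:
  "map_poly ncpoly_of (P * Q) = sh_poly (map_poly ncpoly_of P) (map_poly ncpoly_of Q)"
proof -
  have z: "ncpoly_of 0 = 0" by transfer simp
  have deg: "degree (map_poly ncpoly_of P) = degree P" for P :: "'a shuffle poly"
    by (rule degree_map_poly) (metis ncpoly_of_inject z)
  have add: "map_poly ncpoly_of (P + Q) = map_poly ncpoly_of P + map_poly ncpoly_of Q"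
    for P Q :: "'a shuffle poly"
    by (rule map_poly_add_hom) (transfer; simp)+
  have sum: "map_poly ncpoly_of (\<Sum>i\<in>I. f i) = (\<Sum>i\<in>I. map_poly ncpoly_of (f i))"
    for f :: "nat \<Rightarrow> 'a shuffle poly" and I
    by (induction I rule: infinite_finite_induct) (simp_all add: add)
  have "P * Q = (\<Sum>i\<le>degree P. \<Sum>j\<le>degree Q. monom (coeff P i * coeff Q j) (i + j))"
    by (subst (1 3) poly_as_sum_of_monoms[symmetric])
       (simp only: sum_product mult_monom)
  then show ?thesis
    by (simp add: sum map_poly_monom z times_shuffle.rep_eq sh_poly_def deg coeff_map_poly)
qed

text \<open>
  The regularization on the shuffle algebra: trailing letters \<open>x\<^sub>0\<close> are projected away, and the result
  is expanded in powers of the slice \<open>x\<^sub>1\<close>, which becomes the variable \<open>T\<close>.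
\<close>
definition reg_shuffle :: "('g, 'm) monoid_scheme \<Rightarrow> 'g shuffle \<Rightarrow> 'g shuffle poly" where
  "reg_shuffle G x = leading.proj_taylor (Some \<one>\<^bsub>G\<^esub>) (trailing.proj None x)"

lemma is_reg_reg:
  assumes "finite (carrier G)" "\<one>\<^bsub>G\<^esub> \<in> carrier G"
  shows "is_reg G (reg G)"
proof -
  define e where "e = Some \<one>\<^bsub>G\<^esub>"
  define R where "R v = map_poly ncpoly_of (reg_shuffle G (shuffle_of v))" for v
  have z: "ncpoly_of 0 = 0" by transfer simp
  have coeff_R: "coeff (R v) n = ncpoly_of (leading.proj e (leading.divpow e n (trailing.proj None (shuffle_of v))))"
    for v n
    by (simp add: R_def reg_shuffle_def coeff_map_poly z leading.coeff_proj_taylor e_def)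
  have add: "R (v + w) = R v + R w" for v w
    unfolding R_def reg_shuffle_def
    by (simp add: plus_shuffle.abs_eq[symmetric] trailing.proj_add leading.proj_taylor_add map_poly_add_hom z
        plus_shuffle.rep_eq)
  have scale: "R (c *\<^sub>Q v) = c *\<^sub>Q R v" for c v
    by (rule poly_eqI)
       (simp add: coeff_R coeff_scaleQ scaleQ_shuffle.abs_eq[symmetric] trailing.proj_scaleQ
         leading.divpow_scaleQ leading.proj_scaleQ scaleQ_shuffle.rep_eq)
  have mult: "R (sh v w) = sh_poly (R v) (R w)" for v w
    by (simp add: R_def reg_shuffle_def times_shuffle.abs_eq[symmetric] trailing.proj_mult
        leading.proj_taylor_mult map_poly_ncpoly_of_mult)
  have const: "R v = [:v:]" if "v \<in> HG0 G" for v
  proof -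
    have "ldel e v = 0" "rdel None v = 0"
      using that HG0_iff[OF assms(1)] by (simp_all add: e_def)
    then have "ldel_shuffle e (shuffle_of v) = 0" "rdel_shuffle None (shuffle_of v) = 0"
      by (simp_all add: ldel_shuffle.abs_eq rdel_shuffle.abs_eq zero_shuffle.abs_eq)
    then show ?thesis
      by (simp add: R_def reg_shuffle_def e_def[symmetric] trailing.proj_const leading.proj_taylor_const
          map_poly_pCons z shuffle_of_inverse)
  qed
  have one: "1 \<in> HG0 G" by (simp add: HG0_iff assms(1))
  have HG0: "coeff (R v) n \<in> HG0 G" if "v \<in> HG G" for v n
  proof -
    define S where "S = {x. ncpoly_of x \<in> HG G}"
    have S: "x + y \<in> S" "x * y \<in> S" if "x \<in> S" "y \<in> S" for x y
      using that by (simp_all add: S_def plus_shuffle.rep_eq times_shuffle.rep_eq HG_add HG_sh)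
    have S': "ldel_shuffle l x \<in> S" "rdel_shuffle l x \<in> S" "c *\<^sub>Q x \<in> S" if "x \<in> S" for x c l
      using that
      by (simp_all add: S_def ldel_shuffle.rep_eq rdel_shuffle.rep_eq scaleQ_shuffle.rep_eq
          HG_ldel HG_rdel HG_scaleQ)
    have letters: "letter e \<in> S" "letter None \<in> S" "shuffle_of v \<in> S"
      using assms that
      by (simp_all add: S_def letter.rep_eq HG_xx letters_def e_def shuffle_of_inverse)
    define x where "x = trailing.proj None (shuffle_of v)"
    define y where "y = leading.divpow e n x"
    have "x \<in> S"
      unfolding x_def by (rule trailing.proj_closed[of S]) (simp_all add: S S' letters)
    then have "y \<in> S"
      unfolding y_def by (intro leading.divpow_closed[of S]) (simp_all add: S')
    then have "leading.proj e y \<in> S"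
      by (intro leading.proj_closed[of S]) (simp_all add: S S' letters)
    moreover have "ldel_shuffle e (leading.proj e y) = 0"
      by (rule leading.D_proj)
    moreover have "rdel_shuffle None (leading.proj e y) = 0"
    proof (rule leading.proj_commuting_derivation)
      show comm: "rdel_shuffle None (ldel_shuffle e z) = ldel_shuffle e (rdel_shuffle None z)" for z
        by transfer (simp add: ldel_rdel_commute)
      show "rdel_shuffle None (letter e) = 0"
        unfolding e_def by transfer (simp add: rdel_xx)
      have "rdel_shuffle None (leading.divpow e m x) = 0" for m
        by (induction m)
           (simp_all add: x_def trailing.D_proj leading.divpow_Suc trailing.scaleQ comm leading.zero del: of_nat_Suc)
      then show "rdel_shuffle None y = 0"
        by (simp add: y_def)
    qed (rule trailing.derivation_axioms)
    ultimately show ?thesis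
      unfolding coeff_R HG0_iff[OF assms(1)] S_def x_def[symmetric] y_def[symmetric] e_def[symmetric]
      by (simp add: ldel_shuffle.rep_eq[symmetric] rdel_shuffle.rep_eq[symmetric] z)
  qed
  have x0: "R (xx None) = 0"
    by (simp add: R_def reg_shuffle_def letter.abs_eq[symmetric] trailing.proj_slice leading.proj_taylor_const
        leading.zero map_poly_pCons z)
  have "rdel_shuffle None (letter e) = 0"
    unfolding e_def by transfer (simp add: rdel_xx)
  then have x1: "R (xx e) = [:0, 1:]"
    by (simp add: R_def reg_shuffle_def letter.abs_eq[symmetric] e_def[symmetric] trailing.proj_const
        leading.proj_taylor_slice map_poly_pCons z one_shuffle.rep_eq)
  have "is_reg G R"
    unfolding is_reg_def rat_alg_hom_on_def rat_linear_on_def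
    using add scale mult const HG0 x0 x1 one by (auto simp: e_def)
  then show ?thesis
    unfolding reg_def by (rule someI[of "is_reg G"])
qed

section \<open>Module automorphisms given by exponential series\<close>

lemma scaleQ_conv_smult: "c *\<^sub>Q p = smult (c *\<^sub>Q 1) p" for p :: "'a :: comm_rat_algebra_1 poly"
  by (rule poly_eqI) (simp add: coeff_scaleQ mult_scaleQ_left)

lemma smult_sum_right: "smult c (\<Sum>i\<in>I. f i) = (\<Sum>i\<in>I. smult c (f i))"
  by (induction I rule: infinite_finite_induct) (simp_all add: smult_add_right)

lemma module_smult: "module (smult :: 'a :: comm_ring_1 \<Rightarrow> _)"
  by standard (simp_all add: smult_add_right smult_add_left)

lemma module_hom_smult_iff:
  "module_hom smult smult f \<longleftrightarrow> (\<forall>p q. f (p + q) = f p + f q) \<and> (\<forall>c p. f (smult c p) = smult c (f p))"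
  for f :: "'a :: comm_ring_1 poly \<Rightarrow> 'a poly"
  by (simp add: module_hom_iff module_smult)

text \<open>
  Prescribing monic images \<open>C n\<close> of degree \<open>n\<close> for the powers of the variable defines an automorphism
  of the module of polynomials. Surjectivity is by elimination of the leading term.
\<close>
lemma unitriangular_module_automorphism:
  fixes C :: "nat \<Rightarrow> 'a :: comm_ring_1 poly"
  assumes deg: "\<And>n m. n < m \<Longrightarrow> coeff (C n) m = 0" and lead: "\<And>n. coeff (C n) n = 1"
  obtains f where "module_hom smult smult f" "bij f" "\<And>n. f (monom 1 n) = C n"
proof -
  define f where "f p = (\<Sum>n\<le>degree p. smult (coeff p n) (C n))" for p
  have f: "f p = (\<Sum>n\<le>N. smult (coeff p n) (C n))" if "degree p \<le> N" for p N
    unfolding f_def using that by (intro sum.mono_neutral_left) (auto simp: coeff_eq_0)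
  have add: "f (p + q) = f p + f q" for p q
  proof -
    define N where "N = max (degree p) (degree q)"
    have "degree p \<le> N" "degree q \<le> N" "degree (p + q) \<le> N"
      using degree_add_le_max[of p q] by (auto simp: N_def)
    then show ?thesis
      by (simp add: f[of _ N] smult_add_left sum.distrib)
  qed
  have scale: "f (smult c p) = smult c (f p)" for c p
    using f[of "smult c p" "degree p"] degree_smult_le[of c p]
    by (simp add: f_def smult_sum_right)
  have monom: "f (monom c n) = smult c (C n)" for c n
  proof -
    have "(\<Sum>i\<le>n. smult (coeff (monom c n) i) (C i)) = (\<Sum>i\<le>n. if i = n then smult c (C n) else 0)"
      by (intro sum.cong) auto
    with f[OF degree_monom_le[of c n]] show ?thesis by simp
  qed
  have zero: "f 0 = 0"
    by (simp add: f_def)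
  have minus: "f (p - q) = f p - f q" for p q
    using add[of "p - q" q] by simp
  have "inj f"
  proof (rule injI)
    fix p q assume "f p = f q"
    define r where "r = p - q"
    have "coeff (f r) (degree r) = (\<Sum>n\<le>degree r. coeff r n * coeff (C n) (degree r))"
      by (simp add: f_def coeff_sum)
    also have "\<dots> = (\<Sum>n\<le>degree r. if n = degree r then coeff r n else 0)"
      by (intro sum.cong) (auto simp: lead deg)
    also have "\<dots> = lead_coeff r" by simp
    finally have "lead_coeff r = 0"
      using \<open>f p = f q\<close> minus[of p q] by (simp add: r_def)
    then show "p = q"
      by (simp only: leading_coeff_0_iff r_def right_minus_eq)
  qed
  moreover have "\<exists>p. q = f p" if "\<And>m. m \<ge> N \<Longrightarrow> coeff q m = 0" for N q
    using that
  proof (induction N arbitrary: q)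
    case 0
    then have "q = 0" by (intro poly_eqI) simp
    then show ?case using zero by metis
  next
    case (Suc N)
    let ?r = "q - f (monom (coeff q N) N)"
    have "coeff ?r m = 0" if "m \<ge> N" for m
      using that Suc.prems[of m] by (cases "m = N") (simp_all add: monom lead deg)
    then obtain p where "?r = f p" using Suc.IH by blast
    then have "q = f (p + monom (coeff q N) N)" by (simp add: add algebra_simps)
    then show ?case ..
  qed
  then have "surj f"
    unfolding surj_def by (metis coeff_eq_0 not_less less_Suc_eq_le)
  ultimately have "bij f" by (simp add: bij_def)
  with add scale monom show ?thesis
    by (intro that[of f]) (auto simp: module_hom_smult_iff)
qed

lemma fps_nth_exp_Tu: "fps_nth (exp_Tu :: 'a :: comm_rat_algebra_1 poly fps) n = monom ((1 / fact n) *\<^sub>Q 1) n"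
proof -
  have "fps_nth ((fps_const [:0, 1:] * fps_X) ^ k :: 'a poly fps) n
      = (if k = n then [:0, 1:] ^ n else 0)" for k
    by (simp add: power_mult_distrib fps_const_power fps_X_power_nth)
  then have "fps_nth (exp_Tu :: 'a poly fps) n = (\<Sum>k\<le>n. if k = n then (1 / fact n) *\<^sub>Q [:0, 1:] ^ n else 0)"
    unfolding exp_Tu_def exp_fps_def by (simp only: fps_nth_Abs_fps) (intro sum.cong; simp)
  also have "\<dots> = (1 / fact n) *\<^sub>Q monom 1 n"
    by (simp add: monom_altdef)
  finally show ?thesis by (simp add: scaleQ_conv_smult smult_monom)
qed

lemma sum_const_poly: "(\<Sum>i\<in>I. [:f i:]) = [:\<Sum>i\<in>I. f i:]"
  by (induction I rule: infinite_finite_induct) simp_all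

lemma exp_fps_const_poly:
  "fps_nth (exp_fps (Abs_fps (\<lambda>n. [:fps_nth F n:]))) n = [:fps_nth (exp_fps F) n:]"
proof -
  have "fps_nth (Abs_fps (\<lambda>n. [:fps_nth F n:]) ^ k) n = [:fps_nth (F ^ k) n:]" for k n
    by (induction k arbitrary: n) (auto simp: fps_mult_nth fps_one_nth sum_const_poly one_pCons mult.commute)
  moreover have "c *\<^sub>Q [:a:] = [:c *\<^sub>Q a:]" for c and a :: 'a
    by (simp add: scaleQ_conv_smult mult_scaleQ_left)
  ultimately show ?thesis by (simp add: exp_fps_def sum_const_poly)
qed

text \<open>
  The description of \<open>exp_auto F\<close> is satisfied by exactly one map. Here \<open>B n\<close> is the coefficient of
  index \<open>n\<close> of \<open>exp F * exp (T u)\<close>; it has degree \<open>n\<close> and leading coefficient \<open>1 / n!\<close>.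
\<close>
lemma exp_auto_spec:
  fixes F :: "'a :: comm_rat_algebra_1 fps"
  defines "B \<equiv> \<lambda>n. \<Sum>i\<le>n. monom ((1 / fact (n - i)) *\<^sub>Q fps_nth (exp_fps F) i) (n - i)"
  shows "module_hom smult smult (exp_auto F)" "bij (exp_auto F)"
    "exp_auto F (monom ((1 / fact n) *\<^sub>Q 1) n) = B n"
proof -
  define spec where "spec f \<longleftrightarrow> module_hom smult smult f \<and> bij f \<and>
     Abs_fps (\<lambda>n. f (fps_nth exp_Tu n)) =
       exp_fps (Abs_fps (\<lambda>n. [:fps_nth F n:])) * exp_Tu" for f
  have rhs: "fps_nth (exp_fps (Abs_fps (\<lambda>n. [:fps_nth F n:])) * exp_Tu) n = B n" for n
    by (simp add: fps_mult_nth exp_fps_const_poly fps_nth_exp_Tu B_def smult_monom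
        mult_scaleQ_right atLeast0AtMost)
  have spec_iff: "spec f \<longleftrightarrow> module_hom smult smult f \<and> bij f \<and>
     (\<forall>n. f (monom ((1 / fact n) *\<^sub>Q 1) n) = B n)" for f
    by (simp add: spec_def fps_eq_iff rhs fps_nth_exp_Tu)
  have fact_cancel: "(fact n *\<^sub>Q 1) * ((1 / fact n) *\<^sub>Q x) = x" for n and x :: 'a
    by (simp add: mult_scaleQ_left scaleQ_scaleQ scaleQ_one)
  have coeff_B: "coeff (B n) m = (if m \<le> n then (1 / fact m) *\<^sub>Q fps_nth (exp_fps F) (n - m) else 0)"
    for n m
  proof -
    have "coeff (B n) m = (\<Sum>i\<le>n. if i = n - m \<and> m \<le> n then (1 / fact m) *\<^sub>Q fps_nth (exp_fps F) i else 0)"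
      unfolding B_def coeff_sum by (intro sum.cong) auto
    then show ?thesis by (cases "m \<le> n") simp_all
  qed
  have "fps_nth (exp_fps F) 0 = 1"
    by (simp add: exp_fps_def scaleQ_one)
  then obtain f where f: "module_hom smult smult f" "bij f"
      "\<And>n. f (monom 1 n) = smult (fact n *\<^sub>Q 1) (B n)"
    using unitriangular_module_automorphism[of "\<lambda>n. smult (fact n *\<^sub>Q 1) (B n)" thesis]
    by (simp add: coeff_B fact_cancel)
  have "spec f"
    unfolding spec_iff
  proof (intro conjI f allI)
    fix n
    have "f (smult c (monom 1 n)) = smult c (f (monom 1 n))" for c
      using f(1) by (simp add: module_hom_smult_iff)
    from this[of "(1 / fact n) *\<^sub>Q 1"] show "f (monom ((1 / fact n) *\<^sub>Q 1) n) = B n"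
      by (simp add: f(3) smult_monom mult_scaleQ_left scaleQ_scaleQ scaleQ_one)
  qed
  moreover have "g = f" if "spec g" for g
  proof
    fix p
    have hom: "h p = (\<Sum>n\<le>degree p. smult (coeff p n * (fact n *\<^sub>Q 1)) (B n))" if "spec h" for h
    proof -
      have h: "module_hom smult smult h" "\<And>n. h (monom ((1 / fact n) *\<^sub>Q 1) n) = B n"
        using that by (simp_all add: spec_iff)
      interpret h: module_hom smult smult h by (rule h)
      have "monom (coeff p n) n
          = smult (coeff p n * (fact n *\<^sub>Q 1)) (monom ((1 / fact n) *\<^sub>Q 1) n)" for n
        by (simp add: smult_monom mult.assoc fact_cancel)
      then have "h (monom (coeff p n) n) = smult (coeff p n * (fact n *\<^sub>Q 1)) (B n)" for n
        by (simp only: h.scale h(2))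
      moreover have "h p = (\<Sum>n\<le>degree p. h (monom (coeff p n) n))"
        by (subst (1) poly_as_sum_of_monoms[symmetric]) (rule h.sum)
      ultimately show ?thesis by simp
    qed
    show "g p = f p" using hom[OF that] hom[OF \<open>spec f\<close>] by simp
  qed
  ultimately have "spec (THE f. spec f)"
    by (rule theI[of spec f])
  then have "spec (exp_auto F)"
    unfolding exp_auto_def spec_def .
  then show "module_hom smult smult (exp_auto F)" "bij (exp_auto F)"
    "exp_auto F (monom ((1 / fact n) *\<^sub>Q 1) n) = B n"
    by (simp_all add: spec_iff)
qed

lemma exp_auto_add: "exp_auto F (p + q) = exp_auto F p + exp_auto F q"
  using exp_auto_spec(1)[of F] by (simp add: module_hom_smult_iff)

lemma exp_auto_smult: "exp_auto F (smult c p) = smult c (exp_auto F p)"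
  using exp_auto_spec(1)[of F] by (simp add: module_hom_smult_iff)

lemma exp_auto_const [simp]: "exp_auto F [:c:] = [:c:]"
proof -
  have "exp_auto F 1 = 1"
    using exp_auto_spec(3)[of F 0] by (simp add: exp_fps_def scaleQ_one monom_0 one_pCons)
  then show ?thesis
    using exp_auto_smult[of F c 1] by simp
qed

lemma exp_auto_T: "exp_auto F [:0, 1:] = [:fps_nth F 1, 1:]"
proof -
  have "exp_auto F (monom 1 1) = monom 1 1 + [:fps_nth F 1:]"
    using exp_auto_spec(3)[of F 1]
    by (simp add: exp_fps_def scaleQ_one monom_0 fps_one_nth)
  then show ?thesis by (simp add: monom_altdef)
qed

lemma exp_auto_linear: "exp_auto F [:a, b:] = [:a + b * fps_nth F 1, b:]"
proof -
  have "[:a, b:] = [:a:] + smult b [:0, 1:]" by simp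
  then have "exp_auto F [:a, b:] = [:a:] + smult b [:fps_nth F 1, 1:]"
    by (simp only: exp_auto_add exp_auto_smult exp_auto_T exp_auto_const)
  then show ?thesis by simp
qed

lemma exp_auto_T_squared:
  fixes F :: "'a :: comm_rat_algebra_1 fps"
  assumes "fps_nth F 0 = 0" "fps_nth F 2 = 0"
  shows "exp_auto F ([:0, 1:] ^ 2) = [:fps_nth F 1, 1:] ^ 2"
proof -
  have half: "(1 / 2) *\<^sub>Q (2 * x) = x" for x :: 'a
    using of_nat_scaleQ[of 2 x, symmetric] by (simp add: scaleQ_scaleQ scaleQ_one)
  have double: "(2::rat) *\<^sub>Q x = x + x" for x :: 'a
    using scaleQ_add_left[of 1 1 x] by (simp add: scaleQ_one)
  let ?c = "fps_nth F 1"
  have e2: "fps_nth (exp_fps F) 2 = (1 / 2) *\<^sub>Q ?c\<^sup>2"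
    using assms by (simp add: exp_fps_def numeral_2_eq_2 fps_mult_nth power2_eq_square)
  have e01: "fps_nth (exp_fps F) 0 = 1" "fps_nth (exp_fps F) (Suc 0) = ?c"
    by (simp_all add: exp_fps_def scaleQ_one)
  have "exp_auto F (monom ((1 / 2) *\<^sub>Q 1) 2)
      = monom ((1 / 2) *\<^sub>Q 1) 2 + monom ?c 1 + monom ((1 / 2) *\<^sub>Q ?c\<^sup>2) 0"
    using exp_auto_spec(3)[of F 2] e2 e01
    by (simp add: numeral_2_eq_2 scaleQ_one)
  then have "exp_auto F (smult (2 *\<^sub>Q 1) (monom ((1 / 2) *\<^sub>Q 1) 2))
      = smult (2 *\<^sub>Q 1) (monom ((1 / 2) *\<^sub>Q 1) 2 + monom ?c 1 + monom ((1 / 2) *\<^sub>Q ?c\<^sup>2) 0)"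
    by (simp only: exp_auto_smult)
  moreover have "smult (2 *\<^sub>Q 1) (monom ((1 / 2) *\<^sub>Q 1) 2) = ([:0, 1:] ^ 2 :: 'a poly)"
    by (simp add: smult_monom mult_scaleQ_left mult_scaleQ_right scaleQ_scaleQ scaleQ_one monom_altdef)
  moreover have "smult (2 *\<^sub>Q 1) (monom ((1 / 2) *\<^sub>Q 1) 2 + monom ?c 1 + monom ((1 / 2) *\<^sub>Q ?c\<^sup>2) 0)
      = [:?c, 1:] ^ 2"
    by (simp add: smult_add_right smult_monom mult_scaleQ_left mult_scaleQ_right scaleQ_scaleQ
        scaleQ_one double half half[of 1, simplified] monom_altdef power2_eq_square)
  ultimately show ?thesis by simp
qed

section \<open>Relations in weight at most two\<close>

lemma HG0_zero: "0 \<in> HG0 G"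
  by (rule HG0I[of G "\<lambda>_. 0" "\<lambda>_. 0" _ 0]) (simp_all add: HG1_zero)

lemma HG0_sum: "(\<And>i. i \<in> I \<Longrightarrow> f i \<in> HG0 G) \<Longrightarrow> (\<Sum>i\<in>I. f i) \<in> HG0 G"
  by (induction I rule: infinite_finite_induct) (simp_all add: HG0_add HG0_zero)

lemma coeff_sh_poly:
  "coeff (sh_poly P Q) n = (\<Sum>i\<le>degree P. \<Sum>j\<le>degree Q.
     if i + j = n then sh (coeff P i) (coeff Q j) else 0)"
  by (simp add: sh_poly_def coeff_sum)

text \<open>
  The inverse of \<open>q_word\<close>: the group letters are replaced by their partial products, and
  \<open>h\<close> is the preceding partial product.
\<close>
fun unq_word :: "('g, 'm) monoid_scheme \<Rightarrow> 'g \<Rightarrow> 'g word \<Rightarrow> 'g word" where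
  "unq_word G h [] = []"
| "unq_word G h (None # w) = None # unq_word G h w"
| "unq_word G h (Some g # w) = Some (g \<otimes>\<^bsub>G\<^esub> h) # unq_word G (g \<otimes>\<^bsub>G\<^esub> h) w"

text \<open>Linear combinations of letters.\<close>
definition degree_one :: "'g ncpoly set" where
  "degree_one = {p. Poly_Mapping.keys p \<subseteq> range (\<lambda>l. [l])}"

lemma degree_one_xx: "xx l \<in> degree_one"
  by (simp add: degree_one_def xx_def word_poly_def)

lemma degree_one_scaleQ: "p \<in> degree_one \<Longrightarrow> c *\<^sub>Q p \<in> degree_one"
  unfolding degree_one_def by (auto simp: in_keys_iff lookup_scaleQ subset_eq)

lemma degree_one_sum: "(\<And>i. i \<in> I \<Longrightarrow> f i \<in> degree_one) \<Longrightarrow> (\<Sum>i\<in>I. f i) \<in> degree_one"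
  unfolding degree_one_def using keys_sum[of f I] by blast

lemma sh_xx_xx: "sh (xx u) (xx v) = xx u * xx v + xx v * xx u"
  using sh_xx_mult[of u 1 v 1] by simp

lemma sh_degree_one:
  assumes "p \<in> degree_one" "q \<in> degree_one"
  shows "sh p q = p * q + q * p"
  using assms(1)[unfolded degree_one_def, simplified]
proof (induction rule: ncpoly_span_induct)
  case (word v)
  then obtain u where u: "word_poly v = xx u" by (auto simp: xx_def)
  show ?case
    using assms(2)[unfolded degree_one_def, simplified]
  proof (induction rule: ncpoly_span_induct)
    case (word w)
    then obtain u' where "word_poly w = xx u'" by (auto simp: xx_def)
    then show ?case by (simp add: u sh_xx_xx)
  qed (simp_all add: sh_bilinear algebra_simps ncpoly_scaleQ_mult scaleQ_add_right)
qed (simp_all add: sh_bilinear algebra_simps ncpoly_scaleQ_mult scaleQ_add_right)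

lemma double_cancel:
  fixes x y :: "'a :: rat_vector"
  assumes "x + x = y + y"
  shows "x = y"
proof -
  have "(1 / 2) *\<^sub>Q (x + x) = x" for x :: 'a
    by (simp add: scaleQ_add_right scaleQ_one flip: scaleQ_add_left)
  then show ?thesis using assms by metis
qed

text \<open>
  A homomorphism \<open>Z\<close> from the admissible shuffle algebra of a finite abelian group to a commutative
  rational algebra.
\<close>
locale regularization = comm_group G for G :: "('g, 'm) monoid_scheme" (structure) +
  fixes Z :: "'g ncpoly \<Rightarrow> 'a :: comm_rat_algebra_1"
  assumes finite_carrier: "finite (carrier G)"
    and Z_hom: "rat_alg_hom_on (HG0 G) sh 1 (*) 1 Z"
begin

lemma Z_add: "v \<in> HG0 G \<Longrightarrow> w \<in> HG0 G \<Longrightarrow> Z (v + w) = Z v + Z w"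
  and Z_scaleQ: "v \<in> HG0 G \<Longrightarrow> Z (c *\<^sub>Q v) = c *\<^sub>Q Z v"
  and Z_one: "Z 1 = 1"
  and Z_mult: "v \<in> HG0 G \<Longrightarrow> w \<in> HG0 G \<Longrightarrow> Z (sh v w) = Z v * Z w"
  using Z_hom unfolding rat_alg_hom_on_def rat_linear_on_def by blast+

lemma Z_zero: "Z 0 = 0"
  using Z_scaleQ[OF HG0_zero, of 0] by simp

lemma Z_sum: "(\<And>i. i \<in> I \<Longrightarrow> f i \<in> HG0 G) \<Longrightarrow> Z (\<Sum>i\<in>I. f i) = (\<Sum>i\<in>I. Z (f i))"
  by (induction I rule: infinite_finite_induct) (simp_all add: Z_zero Z_add HG0_sum)

lemma is_reg: "is_reg G (reg G)"
  by (rule is_reg_reg) (simp_all add: finite_carrier)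

lemma HG0_sh: "v \<in> HG0 G \<Longrightarrow> w \<in> HG0 G \<Longrightarrow> sh v w \<in> HG0 G"
  by (simp add: HG0_iff finite_carrier HG_sh ldel_sh rdel_sh)

lemma coeff_Z_sh: "coeff (Z_sh G Z v) n = Z (coeff (reg G v) n)"
  by (simp add: Z_sh_def coeff_map_poly Z_zero)

lemma coeff_reg: "v \<in> HG G \<Longrightarrow> coeff (reg G v) n \<in> HG0 G"
  using is_reg unfolding is_reg_def by blast

lemma reg_add: "v \<in> HG G \<Longrightarrow> w \<in> HG G \<Longrightarrow> reg G (v + w) = reg G v + reg G w"
  and reg_scaleQ: "v \<in> HG G \<Longrightarrow> reg G (c *\<^sub>Q v) = c *\<^sub>Q reg G v"
  and reg_sh: "v \<in> HG G \<Longrightarrow> w \<in> HG G \<Longrightarrow> reg G (sh v w) = sh_poly (reg G v) (reg G w)"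
  and reg_HG0: "v \<in> HG0 G \<Longrightarrow> reg G v = [:v:]"
  and reg_x0: "reg G (xx None) = 0"
  and reg_x1: "reg G (xx (Some \<one>)) = [:0, 1:]"
  using is_reg unfolding is_reg_def rat_alg_hom_on_def rat_linear_on_def by blast+

lemma Z_sh_add: "v \<in> HG G \<Longrightarrow> w \<in> HG G \<Longrightarrow> Z_sh G Z (v + w) = Z_sh G Z v + Z_sh G Z w"
  by (rule poly_eqI) (simp add: coeff_Z_sh reg_add Z_add coeff_reg)

lemma Z_sh_scaleQ: "v \<in> HG G \<Longrightarrow> Z_sh G Z (c *\<^sub>Q v) = c *\<^sub>Q Z_sh G Z v"
  by (rule poly_eqI) (simp add: coeff_Z_sh reg_scaleQ coeff_scaleQ Z_scaleQ coeff_reg)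

lemma Z_sh_HG0: "v \<in> HG0 G \<Longrightarrow> Z_sh G Z v = [:Z v:]"
  by (rule poly_eqI) (simp add: coeff_Z_sh reg_HG0 coeff_pCons Z_zero split: nat.split)

lemma Z_sh_sum: "(\<And>i. i \<in> I \<Longrightarrow> f i \<in> HG G) \<Longrightarrow> Z_sh G Z (\<Sum>i\<in>I. f i) = (\<Sum>i\<in>I. Z_sh G Z (f i))"
  by (induction I rule: infinite_finite_induct)
     (simp_all add: Z_sh_HG0 HG0_zero Z_zero Z_sh_add HG_sum)

lemma Z_sh_x0: "Z_sh G Z (xx None) = 0"
  by (rule poly_eqI) (simp add: coeff_Z_sh reg_x0 Z_zero)

lemma Z_sh_x1: "Z_sh G Z (xx (Some \<one>)) = [:0, 1:]"
  by (rule poly_eqI) (simp add: coeff_Z_sh reg_x1 coeff_pCons Z_zero Z_one split: nat.split)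

lemma Z_sh_mult:
  assumes "v \<in> HG G" "w \<in> HG G"
  shows "Z_sh G Z (sh v w) = Z_sh G Z v * Z_sh G Z w"
proof (rule poly_eqI)
  fix n
  let ?P = "reg G v" and ?Q = "reg G w"
  let ?t = "\<lambda>i j. if i + j = n then sh (coeff ?P i) (coeff ?Q j) else 0"
  have t: "?t i j \<in> HG0 G" for i j
    by (simp add: HG0_zero HG0_sh coeff_reg assms)
  have "coeff (Z_sh G Z (sh v w)) n = Z (\<Sum>i\<le>degree ?P. \<Sum>j\<le>degree ?Q. ?t i j)"
    by (simp add: coeff_Z_sh reg_sh assms coeff_sh_poly)
  also have "\<dots> = (\<Sum>i\<le>degree ?P. \<Sum>j\<le>degree ?Q. Z (?t i j))"
    by (simp only: Z_sum HG0_sum t)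
  also have "\<dots> = (\<Sum>i\<le>degree ?P. \<Sum>j\<le>degree ?Q. if i + j = n then Z (coeff ?P i) * Z (coeff ?Q j) else 0)"
    by (intro sum.cong) (simp_all add: Z_zero Z_mult coeff_reg assms)
  also have "\<dots> = coeff (Z_sh G Z v * Z_sh G Z w) n"
    by (simp add: Z_sh_def map_poly_as_sum[of Z, OF Z_zero] sum_product mult_monom coeff_sum)
  finally show "coeff (Z_sh G Z (sh v w)) n = coeff (Z_sh G Z v * Z_sh G Z w) n" .
qed

lemma Z_sh_degree_one:
  assumes "p \<in> HG G \<inter> degree_one" "q \<in> HG G \<inter> degree_one"
  shows "Z_sh G Z (p * q) = Z_sh G Z p * Z_sh G Z q - Z_sh G Z (q * p)"
  using Z_sh_mult[of p q] assms by (simp add: sh_degree_one Z_sh_add HG_mult eq_diff_eq)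

lemma HG_x0: "xx None \<in> HG G" and HG_xg: "g \<in> carrier G \<Longrightarrow> xx (Some g) \<in> HG G"
  by (auto simp: HG_xx letters_def)

lemma HG0_xg: "g \<in> carrier G - {\<one>} \<Longrightarrow> xx (Some g) \<in> HG0 G"
  and HG0_xgxh: "g \<in> carrier G - {\<one>} \<Longrightarrow> h \<in> carrier G \<Longrightarrow> xx (Some g) * xx (Some h) \<in> HG0 G"
  and HG0_x0xg: "h \<in> carrier G \<Longrightarrow> xx None * xx (Some h) \<in> HG0 G"
  by (auto simp: HG0_iff finite_carrier HG_mult HG_x0 HG_xg ldel_xx rdel_xx ldel_xx_mult rdel_mult_xx)

text \<open>The values of \<open>Z\<close> at the words of weight at most two: \<open>x\<^sub>g\<close>, \<open>x\<^sub>g x\<^sub>h\<close> and \<open>x\<^sub>0 x\<^sub>g\<close>. \<open>Z\<close> is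
  unconstrained at \<open>x\<^sub>1\<close> and \<open>x\<^sub>1 x\<^sub>h\<close>, so \<open>z1 g\<close> and \<open>z2 g h\<close> are meaningful only for \<open>g \<noteq> 1\<close>.\<close>
definition z1 :: "'g \<Rightarrow> 'a" where "z1 g = Z (xx (Some g))"
definition z2 :: "'g \<Rightarrow> 'g \<Rightarrow> 'a" where "z2 g h = Z (xx (Some g) * xx (Some h))"
definition w2 :: "'g \<Rightarrow> 'a" where "w2 g = Z (xx None * xx (Some g))"

lemma Z_sh_xg: "g \<in> carrier G - {\<one>} \<Longrightarrow> Z_sh G Z (xx (Some g)) = [:z1 g:]"
  by (simp add: z1_def Z_sh_HG0 HG0_xg)

lemma Z_sh_xgxh:
  "g \<in> carrier G - {\<one>} \<Longrightarrow> h \<in> carrier G \<Longrightarrow> Z_sh G Z (xx (Some g) * xx (Some h)) = [:z2 g h:]"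
  by (simp add: z2_def Z_sh_HG0 HG0_xgxh)

lemma Z_sh_x0xg: "g \<in> carrier G \<Longrightarrow> Z_sh G Z (xx None * xx (Some g)) = [:w2 g:]"
  by (simp add: w2_def Z_sh_HG0 HG0_x0xg)

lemma Z_sh_xx_mult:
  "u \<in> letters G \<Longrightarrow> v \<in> letters G \<Longrightarrow>
    Z_sh G Z (xx u * xx v) = Z_sh G Z (xx u) * Z_sh G Z (xx v) - Z_sh G Z (xx v * xx u)"
  by (intro Z_sh_degree_one) (simp_all add: degree_one_xx HG_xx)

lemma Z_sh_x1xg:
  assumes "g \<in> carrier G - {\<one>}"
  shows "Z_sh G Z (xx (Some \<one>) * xx (Some g)) = [:- z2 g \<one>, z1 g:]"
  using assms Z_sh_xx_mult[of "Some \<one>" "Some g"]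
  by (simp add: letters_def Z_sh_x1 Z_sh_xg Z_sh_xgxh)

lemma shuffle_relation:
  assumes "g \<in> carrier G - {\<one>}" "h \<in> carrier G - {\<one>}"
  shows "z1 g * z1 h = z2 g h + z2 h g"
  using assms Z_sh_xx_mult[of "Some g" "Some h"]
  by (simp add: letters_def Z_sh_xg Z_sh_xgxh)

lemma unq_q_word:
  "h \<in> carrier G \<Longrightarrow> set w \<subseteq> letters G \<Longrightarrow> unq_word G h (q_word G h w) = w"
proof (induction w arbitrary: h)
  case (Cons l w)
  then show ?case
    by (cases l) (auto simp: letters_def m_assoc)
qed simp

lemma inj_on_qG: "inj_on (qG G) (HG G)"
proof (rule inj_on_inverseI)
  fix v assume "v \<in> HG G"
  then show "lin_ext (\<lambda>w. word_poly (unq_word G \<one> w)) (qG G v) = v"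
    by (induction rule: HG_induct) (simp_all add: qG_def lin_ext_add lin_ext_scaleQ unq_q_word)
qed

lemma inv_qG:
  "set w \<subseteq> letters G \<Longrightarrow> inv_into (HG G) (qG G) (word_poly (q_word G \<one> w)) = word_poly w"
  using inv_into_f_f[OF inj_on_qG, of "word_poly w"] by (simp add: HG_word qG_def)

end

lemma harm_xx_xx:
  "harm G (xx (Some a)) (xx (Some b))
    = xx (Some a) * xx (Some b) + xx (Some b) * xx (Some a) + xx None * xx (Some (a \<otimes>\<^bsub>G\<^esub> b))"
  by (simp add: harm_def bilin_ext_def xx_def[of "Some _"] y_word_def yy_def)

text \<open>A homomorphism that satisfies the extended double shuffle relations.\<close>
locale double_shuffle = regularization +
  assumes Z_EDS: "Z \<in> EDS G"
begin

text \<open>The series that defines \<open>rho\<close> starts in degree two, so \<open>rho\<close> fixes polynomials of degree at most one.\<close>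
lemma rho_linear: "rho G Z [:a, b:] = [:a, b:]"
  by (simp add: rho_def exp_auto_linear)

lemma inv_rho_linear: "inv_into UNIV (rho G Z) [:a, b:] = [:a, b:]"
proof -
  have "inj (rho G Z)"
    unfolding rho_def by (rule bij_is_inj[OF exp_auto_spec(2)])
  then show ?thesis
    by (rule inv_f_eq) (rule rho_linear)
qed

text \<open>
  The product \<open>y\<^bsub>1,g\<^esub> * y\<^bsub>1,h\<^esub>\<close>, evaluated under the harmonic homomorphism. Among the
  words in two letters only \<open>x\<^sub>1 x\<^sub>1\<close> has a regularization of degree two; it is excluded by \<open>h \<noteq> 1\<close>, so \<open>rho\<close> plays no role.
\<close>
lemma harm_relation:
  assumes g: "g \<in> carrier G" and h: "h \<in> carrier G - {\<one>}"
  shows "Z_sh G Z (xx (Some g)) * Z_sh G Z (xx (Some h))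
      = Z_sh G Z (xx (Some g) * xx (Some (g \<otimes> h))) + Z_sh G Z (xx (Some h) * xx (Some (g \<otimes> h)))
        + Z_sh G Z (xx None * xx (Some (g \<otimes> h)))"
proof -
  define f where "f = inv_into UNIV (rho G Z) \<circ> Z_sh G Z \<circ> inv_into (HG G) (qG G)"
  have f: "rat_alg_hom_on (HG1 G) (harm G) 1 (*) 1 f"
    using Z_EDS by (simp add: EDS_def f_def)
  have f_word: "f (word_poly (q_word G \<one> w)) = Z_sh G Z (word_poly w)"
    if "set w \<subseteq> letters G" "Z_sh G Z (word_poly w) = [:a, b:]" for w a b
    using that by (simp add: f_def inv_qG inv_rho_linear)
  have linear: "\<exists>a b. Z_sh G Z (xx (Some k)) = [:a, b:]" if "k \<in> carrier G" for k
    using that Z_sh_x1 Z_sh_xg[of k] by (cases "k = \<one>") auto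
  have linear2: "\<exists>a b. Z_sh G Z (xx (Some k) * xx (Some l)) = [:a, b:]"
    if "k \<in> carrier G" "l \<in> carrier G" "k \<noteq> \<one> \<or> l \<noteq> \<one>" for k l
    using that Z_sh_x1xg[of l] Z_sh_xgxh[of k l] by (cases "k = \<one>") auto
  have f1: "f (xx (Some k)) = Z_sh G Z (xx (Some k))" if k: "k \<in> carrier G" for k
  proof -
    obtain a b where "Z_sh G Z (xx (Some k)) = [:a, b:]" using linear[OF k] by blast
    then show ?thesis using f_word[of "[Some k]"] k by (simp add: xx_def letters_def)
  qed
  have f2: "f (xx (Some k) * xx (Some l)) = Z_sh G Z (xx (Some k) * xx (Some (k \<otimes> l)))"
    if kl: "k \<in> carrier G" "l \<in> carrier G" "k \<noteq> \<one> \<or> l \<noteq> \<one>" for k l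
  proof -
    obtain a b where "Z_sh G Z (xx (Some k) * xx (Some (k \<otimes> l))) = [:a, b:]"
      using linear2[of k "k \<otimes> l"] kl by (metis l_one m_closed)
    moreover have "k \<otimes> l \<otimes> inv k = l"
      using kl by (metis inv_closed m_closed m_comm r_inv r_one m_assoc)
    ultimately show ?thesis
      using f_word[of "[Some k, Some (k \<otimes> l)]"] kl
      by (simp add: xx_def letters_def word_poly_mult)
  qed
  have f0: "f (xx None * xx (Some k)) = Z_sh G Z (xx None * xx (Some k))" if "k \<in> carrier G" for k
    using f_word[of "[None, Some k]" "w2 k" 0] Z_sh_x0xg[of k] that
    by (simp add: xx_def letters_def word_poly_mult)
  have HG1: "xx (Some k) \<in> HG1 G" "xx (Some k) * xx (Some l) \<in> HG1 G" "xx None * xx (Some l) \<in> HG1 G"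
    if "k \<in> carrier G" "l \<in> carrier G" for k l
    using that
    by (auto simp: xx_def word_poly_mult letters_def intro!: HG1_word finite_carrier)
  have f_add: "f (v + w) = f v + f w" if "v \<in> HG1 G" "w \<in> HG1 G" for v w
    using f that by (simp add: rat_alg_hom_on_def rat_linear_on_def)
  have "h \<in> carrier G" using h by simp
  note HG1' = HG1[OF g this] HG1[OF this g] HG1[OF g m_closed[OF g this]]
  have "f (xx (Some g)) * f (xx (Some h)) = f (harm G (xx (Some g)) (xx (Some h)))"
    using f HG1' by (simp add: rat_alg_hom_on_def)
  also have "\<dots> = f (xx (Some g) * xx (Some h)) + f (xx (Some h) * xx (Some g))
      + f (xx None * xx (Some (g \<otimes> h)))"
    unfolding harm_xx_xx by (simp only: f_add HG1_add HG1')
  finally show ?thesis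
    using g h m_comm[of h g] by (simp add: f0 f1 f2)
qed

lemma harmonic_relation:
  assumes "g \<in> carrier G - {\<one>}" "h \<in> carrier G - {\<one>}"
  shows "z1 g * z1 h = z2 g (g \<otimes> h) + z2 h (g \<otimes> h) + w2 (g \<otimes> h)"
  using assms harm_relation[of g h]
  by (simp add: Z_sh_xg Z_sh_xgxh Z_sh_x0xg mult.commute)

text \<open>
  This is the case \<open>g = 1\<close> of the harmonic relation: the terms linear in \<open>T\<close> cancel, and \<open>x\<^sub>1 x\<^sub>g\<close> has
  the constant term \<open>- z2 g 1\<close>.
\<close>
lemma regularized_relation:
  assumes "g \<in> carrier G - {\<one>}"
  shows "w2 g = z2 g \<one> - z2 g g"
  using assms harm_relation[of \<one> g]
  by (simp add: Z_sh_xg Z_sh_xgxh Z_sh_x0xg Z_sh_x1 Z_sh_x1xg algebra_simps)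

lemma sum_subgroup_translate:
  assumes "subgroup K G" "a \<in> K"
  shows "(\<Sum>b\<in>K. f (a \<otimes> b)) = (\<Sum>b\<in>K. f b)"
proof -
  have K: "x \<in> carrier G" if "x \<in> K" for x
    using that subgroup.mem_carrier[OF assms(1)] by blast
  show ?thesis
    using assms K
    by (intro sum.reindex_bij_witness[of _ "\<lambda>b. inv a \<otimes> b" "\<lambda>b. a \<otimes> b"])
       (auto simp: subgroup.m_closed subgroup.m_inv_closed m_assoc[symmetric])
qed

section \<open>Distribution relations in weight two\<close>

text \<open>
  The sum of \<open>z1 a * z1 b\<close> over \<open>a, b \<in> K - {1}\<close> is expanded by the shuffle and by the harmonic
  relation. The terms \<open>z2 a b\<close> with \<open>a, b \<noteq> 1\<close> cancel, and the boundary terms \<open>z2 a 1 - z2 a a\<close>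
  of the translated sums are \<open>w2 a\<close>.
\<close>
lemma distribution_at_one:
  assumes K: "subgroup K G"
  shows "of_nat (card K) * (\<Sum>g\<in>K. w2 g) = w2 \<one>"
proof -
  have KG: "K \<subseteq> carrier G" by (rule subgroup.subset[OF K])
  then have fin: "finite K" by (rule finite_subset[OF _ finite_carrier])
  have one: "\<one> \<in> K" by (rule subgroup.one_closed[OF K])
  define K' where "K' = K - {\<one>}"
  have K': "g \<in> carrier G - {\<one>}" if "g \<in> K'" for g
    using that KG by (auto simp: K'_def)
  have sum_K': "(\<Sum>b\<in>K'. f b) = (\<Sum>b\<in>K. f b) - f \<one>" for f :: "'a \<Rightarrow> 'c"
    by (simp add: K'_def sum_diff1 fin one)
  have translate: "(\<Sum>b\<in>K'. f (a \<otimes> b)) = (\<Sum>b\<in>K'. f b) + f \<one> - f a"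
    if "a \<in> K'" for a and f :: "'a \<Rightarrow> 'c"
  proof -
    have "a \<in> K" "a \<in> carrier G" using that KG by (auto simp: K'_def)
    then show ?thesis
      by (simp add: sum_K' sum_subgroup_translate[OF K])
  qed
  define W where "W = (\<Sum>g\<in>K. w2 g)"
  define S where "S = (\<Sum>a\<in>K'. \<Sum>b\<in>K'. z1 a * z1 b)"
  define X where "X = (\<Sum>a\<in>K'. \<Sum>b\<in>K'. z2 a b)"
  have swap: "(\<Sum>a\<in>K'. \<Sum>b\<in>K'. f b a) = (\<Sum>a\<in>K'. \<Sum>b\<in>K'. f a b)" for f :: "'a \<Rightarrow> 'a \<Rightarrow> 'c"
    by (rule sum.swap)
  have "S = (\<Sum>a\<in>K'. \<Sum>b\<in>K'. z2 a b + z2 b a)"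
    unfolding S_def by (intro sum.cong refl shuffle_relation K')
  also have "\<dots> = X + X"
    by (simp add: sum.distrib X_def swap[of z2])
  finally have S1: "S = X + X" .
  have Y: "(\<Sum>a\<in>K'. \<Sum>b\<in>K'. z2 a (a \<otimes> b)) = X + (\<Sum>a\<in>K'. w2 a)"
  proof -
    have "(\<Sum>a\<in>K'. \<Sum>b\<in>K'. z2 a (a \<otimes> b)) = (\<Sum>a\<in>K'. (\<Sum>b\<in>K'. z2 a b) + w2 a)"
      by (intro sum.cong refl) (simp add: translate regularized_relation[OF K'])
    then show ?thesis by (simp add: sum.distrib X_def)
  qed
  have "S = (\<Sum>a\<in>K'. \<Sum>b\<in>K'. z2 a (a \<otimes> b) + z2 b (b \<otimes> a) + w2 (a \<otimes> b))"
    unfolding S_def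
    by (intro sum.cong refl) (use K' harmonic_relation m_comm in fastforce)
  also have "\<dots> = (\<Sum>a\<in>K'. \<Sum>b\<in>K'. z2 a (a \<otimes> b)) + (\<Sum>a\<in>K'. \<Sum>b\<in>K'. z2 a (a \<otimes> b))
      + (\<Sum>a\<in>K'. \<Sum>b\<in>K'. w2 (a \<otimes> b))"
    by (simp add: sum.distrib swap[of "\<lambda>a b. z2 a (a \<otimes> b)"])
  also have "(\<Sum>a\<in>K'. \<Sum>b\<in>K'. w2 (a \<otimes> b)) = (\<Sum>a\<in>K'. W - w2 a)"
    by (intro sum.cong refl, simp only: translate) (simp add: sum_K' W_def)
  finally have "0 = (\<Sum>a\<in>K'. w2 a) + of_nat (card K') * W"
    unfolding S1 Y by (simp add: sum_subtractf algebra_simps)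
  also have "\<dots> = of_nat (card K' + 1) * W - w2 \<one>"
    by (simp add: sum_K' W_def algebra_simps)
  also have "card K' + 1 = card K"
    using fin one by (simp add: K'_def card_gt_0_iff) (metis card_gt_0_iff Suc_pred empty_iff)
  finally show ?thesis by (simp add: W_def)
qed

text \<open>
  For each \<open>k \<noteq> 1\<close> the difference of the shuffle and the harmonic expansion of \<open>z1 g * z1 k\<close> contains
  \<open>z2 k (g k) - z2 k g\<close>, which cancels in the sum over \<open>F\<close>, as \<open>g \<mapsto> g k\<close> permutes \<open>F\<close>; the term \<open>k = 1\<close> is the regularized
  relation.
\<close>
lemma coset_relation:
  assumes K: "K \<subseteq> carrier G" and F: "finite F" "F \<subseteq> carrier G - {\<one>}"
    and translate: "\<And>k. k \<in> K \<Longrightarrow> bij_betw (\<lambda>g. g \<otimes> k) F F"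
  shows "(\<Sum>g\<in>F. \<Sum>k\<in>K. z2 g k - z2 g (g \<otimes> k)) = of_nat (card K) * (\<Sum>g\<in>F. w2 g)"
proof -
  have "(\<Sum>g\<in>F. z2 g k - z2 g (g \<otimes> k)) = (\<Sum>g\<in>F. w2 g)" if k: "k \<in> K" for k
  proof (cases "k = \<one>")
    case True
    show ?thesis
      by (intro sum.cong refl) (use F regularized_relation True in \<open>force simp: r_one\<close>)
  next
    case False
    have shift: "(\<Sum>g\<in>F. f (g \<otimes> k)) = (\<Sum>g\<in>F. f g)" for f :: "'a \<Rightarrow> 'c"
      by (rule sum.reindex_bij_betw[OF translate[OF k]])
    have "z2 g k - z2 g (g \<otimes> k) = z2 k (g \<otimes> k) - z2 k g + w2 (g \<otimes> k)" if "g \<in> F" for g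
    proof -
      have "g \<in> carrier G - {\<one>}" "k \<in> carrier G - {\<one>}"
        using that F k K False by auto
      then show ?thesis
        using shuffle_relation[of g k] harmonic_relation[of g k] by (simp add: algebra_simps)
    qed
    then have "(\<Sum>g\<in>F. z2 g k - z2 g (g \<otimes> k)) = (\<Sum>g\<in>F. z2 k (g \<otimes> k) - z2 k g + w2 (g \<otimes> k))"
      by (intro sum.cong) auto
    then show ?thesis
      by (simp add: sum.distrib sum_subtractf shift)
  qed
  then show ?thesis
    by (subst sum.swap) simp
qed

lemma fibre_translate:
  assumes k: "k \<in> ker_pow G d"
  shows "bij_betw (\<lambda>g. g \<otimes> k) {g \<in> carrier G. g [^] d = h} {g \<in> carrier G. g [^] d = h}"
proof -
  have k: "k \<in> carrier G" "k [^] d = \<one>"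
    using k by (simp_all add: ker_pow_def kernel_def)
  then have "inv k [^] d = \<one>"
    by (simp add: nat_pow_inv)
  with k show ?thesis
    by (intro bij_betwI[of _ _ _ "\<lambda>g. g \<otimes> inv k"]) (auto simp: nat_pow_distrib m_assoc)
qed

lemma sum_fibre:
  assumes "g \<in> carrier G" "g [^] d = h"
  shows "(\<Sum>x \<in> {x \<in> carrier G. x [^] d = h}. f x) = (\<Sum>k\<in>ker_pow G d. f (g \<otimes> k))"
proof (rule sum.reindex_bij_witness[of _ "\<lambda>k. g \<otimes> k" "\<lambda>x. inv g \<otimes> x"])
  have "inv g [^] d \<otimes> h = \<one>"
    using assms by (auto simp: nat_pow_inv)
  then show "inv g \<otimes> x \<in> ker_pow G d" if "x \<in> {x \<in> carrier G. x [^] d = h}" for x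
    using that assms(1) by (simp add: ker_pow_def kernel_def nat_pow_distrib)
qed (use assms in \<open>auto simp: ker_pow_def kernel_def nat_pow_distrib m_assoc[symmetric]\<close>)

lemma ker_pow_subgroup: "subgroup (ker_pow G d) G"
  unfolding ker_pow_def
  by (rule group_hom.subgroup_kernel, unfold_locales) (auto simp: hom_def nat_pow_distrib)

text \<open>
  The distribution relation for the words \<open>x\<^sub>0 x\<^sub>g\<close>, from those for \<open>x\<^sub>h x\<^sub>1\<close> and \<open>x\<^sub>h x\<^sub>h\<close>. The
  second one enters after reparametrizing the fibre of \<open>h\<close> as the coset \<open>g K\<close>.
\<close>
lemma distribution:
  assumes h: "h \<in> G_pow G d"
    and z2_one: "h \<noteq> \<one> \<Longrightarrow>
      (\<Sum>g | g \<in> carrier G \<and> g [^] d = h. \<Sum>k\<in>ker_pow G d. z2 g k) = z2 h \<one>"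
    and z2_self: "h \<noteq> \<one> \<Longrightarrow>
      (\<Sum>g | g \<in> carrier G \<and> g [^] d = h. \<Sum>g' | g' \<in> carrier G \<and> g' [^] d = h. z2 g g') = z2 h h"
  shows "of_nat (card (ker_pow G d)) * (\<Sum>g | g \<in> carrier G \<and> g [^] d = h. w2 g) = w2 h"
proof (cases "h = \<one>")
  case True
  have "{g \<in> carrier G. g [^] d = \<one>} = ker_pow G d"
    by (auto simp: ker_pow_def kernel_def)
  then show ?thesis
    using distribution_at_one[OF ker_pow_subgroup[of d]] True by simp
next
  case False
  define F where "F = {g \<in> carrier G. g [^] d = h}"
  define K where "K = ker_pow G d"
  have hG: "h \<in> carrier G - {\<one>}" using h False by (auto simp: G_pow_def)
  have "K \<subseteq> carrier G" by (auto simp: K_def ker_pow_def kernel_def)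
  moreover have "finite F" "F \<subseteq> carrier G - {\<one>}"
    using finite_carrier False by (auto simp: F_def)
  ultimately have "of_nat (card K) * (\<Sum>g\<in>F. w2 g) = (\<Sum>g\<in>F. \<Sum>k\<in>K. z2 g k - z2 g (g \<otimes> k))"
    using coset_relation[of K F] fibre_translate[of _ d h] by (simp add: F_def K_def)
  also have "\<dots> = (\<Sum>g\<in>F. \<Sum>k\<in>K. z2 g k) - (\<Sum>g\<in>F. \<Sum>k\<in>K. z2 g (g \<otimes> k))"
    by (simp add: sum_subtractf)
  also have "(\<Sum>g\<in>F. \<Sum>k\<in>K. z2 g (g \<otimes> k)) = (\<Sum>g\<in>F. \<Sum>g'\<in>F. z2 g g')"
    unfolding F_def K_def by (rule sum.cong[OF refl]) (auto simp: sum_fibre)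
  also have "(\<Sum>g\<in>F. \<Sum>k\<in>K. z2 g k) - (\<Sum>g\<in>F. \<Sum>g'\<in>F. z2 g g') = z2 h \<one> - z2 h h"
    using z2_one z2_self False by (simp add: F_def K_def)
  finally show ?thesis
    using regularized_relation[OF hG] by (simp add: F_def K_def)
qed

end

section \<open>The power map and the inclusion in weight two\<close>

lemma free_hom_xx: "free_hom f (xx u) = f u"
  by (simp add: free_hom_def xx_def)

lemma free_hom_xx_xx: "free_hom f (xx u * xx v) = f u * f v"
  by (simp add: free_hom_def xx_mult_word xx_def[of v])

lemma i_sharp_xx: "i_sharp (xx u) = xx u"
  by (simp add: i_sharp_def free_hom_xx)

lemma i_sharp_xx_xx: "i_sharp (xx u * xx v) = xx u * xx v"
  by (simp add: i_sharp_def free_hom_xx_xx)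

lemma p_sharp_xx_xx: "p_sharp G d (xx u * xx v) = p_sharp G d (xx u) * p_sharp G d (xx v)"
  by (simp add: p_sharp_def free_hom_xx free_hom_xx_xx)

lemma p_sharp_x0: "p_sharp G d (xx None) = of_nat (card (ker_pow G d)) *\<^sub>Q xx None"
  by (simp add: p_sharp_def free_hom_xx)

lemma p_sharp_xg:
  "p_sharp G d (xx (Some h)) = (\<Sum>g | g \<in> carrier G \<and> g [^]\<^bsub>G\<^esub> d = h. xx (Some g))"
  by (simp add: p_sharp_def free_hom_xx)

theorem theorem1:
  fixes G :: "('g, 'm) monoid_scheme"
    and Z :: "'g ncpoly \<Rightarrow> 'a :: comm_rat_algebra_1"
    and d :: nat
  assumes G: "comm_group G" "finite (carrier G)" "carrier G \<noteq> {\<one>\<^bsub>G\<^esub>}"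
    and Z_linear: "rat_linear_on (HG0 G) Z"
    and d: "d > 0" "d dvd Coset.order G"
    and i: "Z \<in> EDS G"
    and ii: "\<forall>h \<in> G_pow G d - {\<one>\<^bsub>G\<^esub>}.
      Z (p_sharp G d (xx (Some h))) = Z (i_sharp (xx (Some h)))"
    and iii: "\<forall>h1 \<in> G_pow G d - {\<one>\<^bsub>G\<^esub>}. \<forall>h2 \<in> G_pow G d.
      Z (p_sharp G d (xx (Some h1) * xx (Some h2))) = Z (i_sharp (xx (Some h1) * xx (Some h2)))"
  shows "\<forall>h1 \<in> insert None (Some ` G_pow G d). \<forall>h2 \<in> insert None (Some ` G_pow G d).
    Z_sh G Z (p_sharp G d (xx h1 * xx h2)) = sigma G d Z (Z_sh G Z (i_sharp (xx h1 * xx h2)))"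
proof -
  interpret comm_group G by (rule G(1))
  interpret double_shuffle G Z
    using G(2) i by unfold_locales (simp_all add: EDS_def)
  define k where "k = card (ker_pow G d)"
  define P where "P u = p_sharp G d (xx u)" for u
  define F where "F h = {g \<in> carrier G. g [^]\<^bsub>G\<^esub> d = h}" for h
  define c where "c = (\<Sum>g\<in>ker_pow G d - {\<one>\<^bsub>G\<^esub>}. z1 g)"
  have P0: "P None = of_nat k *\<^sub>Q xx None"
    by (simp add: P_def p_sharp_x0 k_def)
  have Ph: "P (Some h) = (\<Sum>g\<in>F h. xx (Some g))" for h
    by (simp add: P_def p_sharp_xg F_def)
  have F: "g \<in> carrier G" if "g \<in> F h" for g h
    using that by (simp add: F_def)
  have F': "g \<in> carrier G - {\<one>\<^bsub>G\<^esub>}" if "g \<in> F h" "h \<noteq> \<one>\<^bsub>G\<^esub>" for g h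
    using that by (auto simp: F_def)
  have F1: "F \<one>\<^bsub>G\<^esub> = ker_pow G d"
    by (auto simp: F_def ker_pow_def kernel_def)
  have finF: "finite (F h)" for h
    using G(2) by (simp add: F_def)
  have PG: "P u \<in> HG G \<inter> degree_one" for u
    by (cases u) (auto simp: P0 Ph HG_x0 HG_xg F degree_one_xx
        intro!: HG_scaleQ degree_one_scaleQ HG_sum degree_one_sum)
  have hG: "h \<in> carrier G" if "h \<in> G_pow G d" for h
    using that by (auto simp: G_pow_def)

  have sigma_const: "sigma G d Z [:a:] = [:a:]" for a
    by (simp add: sigma_def)
  have sigma_linear: "sigma G d Z [:a, b:] = [:a + b * c, b:]" for a b
    by (simp add: sigma_def exp_auto_linear c_def z1_def)
  have sigma_square: "sigma G d Z ([:0, 1:] ^ 2) = [:c, 1:] ^ 2"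
    by (simp add: sigma_def exp_auto_T_squared c_def z1_def fps_X_nth)
  have sigma_add: "sigma G d Z (p + q) = sigma G d Z p + sigma G d Z q" for p q
    by (simp add: sigma_def exp_auto_add)

  have P_swap: "Z_sh G Z (P u * P v) = Z_sh G Z (P u) * Z_sh G Z (P v) - Z_sh G Z (P v * P u)" for u v
    by (rule Z_sh_degree_one[OF PG PG])
  have ZP0: "Z_sh G Z (P None) = 0"
    by (simp add: P0 Z_sh_scaleQ HG_x0 Z_sh_x0)
  have ZPh: "Z_sh G Z (P (Some h)) = [:z1 h:]" if h: "h \<in> G_pow G d - {\<one>\<^bsub>G\<^esub>}" for h
  proof -
    have "P (Some h) \<in> HG0 G"
      unfolding Ph using h by (intro HG0_sum HG0_xg F') auto
    moreover have "Z (P (Some h)) = z1 h"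
      using ii h by (simp add: P_def i_sharp_xx z1_def)
    ultimately show ?thesis by (simp add: Z_sh_HG0)
  qed
  have ZP1: "Z_sh G Z (P (Some \<one>\<^bsub>G\<^esub>)) = [:c, 1:]"
  proof -
    have one: "\<one>\<^bsub>G\<^esub> \<in> F \<one>\<^bsub>G\<^esub>" by (simp add: F_def)
    have "Z_sh G Z (P (Some \<one>\<^bsub>G\<^esub>)) = (\<Sum>g\<in>F \<one>\<^bsub>G\<^esub>. Z_sh G Z (xx (Some g)))"
      unfolding Ph by (intro Z_sh_sum HG_xg F)
    also have "\<dots> = [:0, 1:] + (\<Sum>g\<in>F \<one>\<^bsub>G\<^esub> - {\<one>\<^bsub>G\<^esub>}. Z_sh G Z (xx (Some g)))"
      by (simp add: sum.remove[OF finF one] Z_sh_x1)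
    also have "(\<Sum>g\<in>F \<one>\<^bsub>G\<^esub> - {\<one>\<^bsub>G\<^esub>}. Z_sh G Z (xx (Some g))) = (\<Sum>g\<in>F \<one>\<^bsub>G\<^esub> - {\<one>\<^bsub>G\<^esub>}. [:z1 g:])"
      using F by (intro sum.cong refl Z_sh_xg) auto
    also have "\<dots> = [:c:]"
      by (simp add: c_def F1 sum_const_poly)
    finally show ?thesis by simp
  qed
  have Z_PhPg: "Z (P (Some h) * P (Some h')) = (\<Sum>g\<in>F h. \<Sum>g'\<in>F h'. z2 g g')"
    and HG0_PhPg: "P (Some h) * P (Some h') \<in> HG0 G"
    if h: "h \<in> G_pow G d - {\<one>\<^bsub>G\<^esub>}" for h h'
  proof -
    have *: "xx (Some g) * xx (Some g') \<in> HG0 G" if "g \<in> F h" "g' \<in> F h'" for g g'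
      using that h by (intro HG0_xgxh F' F) auto
    then show "P (Some h) * P (Some h') \<in> HG0 G"
      unfolding Ph sum_product by (intro HG0_sum)
    show "Z (P (Some h) * P (Some h')) = (\<Sum>g\<in>F h. \<Sum>g'\<in>F h'. z2 g g')"
      unfolding Ph sum_product z2_def using * by (simp add: Z_sum HG0_sum)
  qed
  have Z_PhPg': "Z (P (Some h) * P (Some h')) = z2 h h'"
    if "h \<in> G_pow G d - {\<one>\<^bsub>G\<^esub>}" "h' \<in> G_pow G d" for h h'
    using iii that by (simp add: P_def p_sharp_xx_xx i_sharp_xx_xx z2_def)
  have one_pow: "\<one>\<^bsub>G\<^esub> \<in> G_pow G d"
    unfolding G_pow_def by (rule image_eqI[of _ _ "\<one>\<^bsub>G\<^esub>"]) simp_all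

  \<comment> \<open>The words \<open>x\<^sub>0 x\<^sub>h\<close>, where the derived distribution relation enters.\<close>
  have main0h: "Z_sh G Z (P None * P (Some h)) = [:w2 h:]" if h: "h \<in> G_pow G d" for h
  proof -
    have "of_nat k * (\<Sum>g\<in>F h. w2 g) = w2 h"
      unfolding k_def F_def
    proof (rule distribution[OF h])
      assume "h \<noteq> \<one>\<^bsub>G\<^esub>"
      then have h': "h \<in> G_pow G d - {\<one>\<^bsub>G\<^esub>}" using h by simp
      show "(\<Sum>g | g \<in> carrier G \<and> g [^]\<^bsub>G\<^esub> d = h. \<Sum>k\<in>ker_pow G d. z2 g k) = z2 h \<one>\<^bsub>G\<^esub>"
        using Z_PhPg[OF h', of "\<one>\<^bsub>G\<^esub>"] Z_PhPg'[OF h' one_pow] by (simp add: F1) (simp add: F_def)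
      show "(\<Sum>g | g \<in> carrier G \<and> g [^]\<^bsub>G\<^esub> d = h.
          \<Sum>g' | g' \<in> carrier G \<and> g' [^]\<^bsub>G\<^esub> d = h. z2 g g') = z2 h h"
        using Z_PhPg[OF h', of h] Z_PhPg'[OF h' h] by (simp add: F_def)
    qed
    moreover have "P None * P (Some h) = of_nat k *\<^sub>Q (\<Sum>g\<in>F h. xx None * xx (Some g))"
      by (simp only: P0 Ph ncpoly_scaleQ_mult_left sum_distrib_left scaleQ_sum)
    moreover have "(\<Sum>g\<in>F h. xx None * xx (Some g)) \<in> HG0 G"
      by (intro HG0_sum HG0_x0xg F)
    ultimately show ?thesis
      by (simp add: Z_sh_HG0 HG0_scaleQ Z_scaleQ Z_sum HG0_x0xg F of_nat_scaleQ flip: w2_def)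
  qed

  have "Z_sh G Z (P u * P v) = sigma G d Z (Z_sh G Z (xx u * xx v))"
    if uv: "u \<in> insert None (Some ` G_pow G d)" "v \<in> insert None (Some ` G_pow G d)" for u v
  proof -
    have uvG: "u \<in> letters G" "v \<in> letters G"
      using uv hG by (auto simp: letters_def)
    consider "u = None" "v = None" | h where "u = None" "v = Some h" "h \<in> G_pow G d"
      | h where "u = Some h" "v = None" "h \<in> G_pow G d"
      | "u = Some \<one>\<^bsub>G\<^esub>" "v = Some \<one>\<^bsub>G\<^esub>"
      | h where "u = Some \<one>\<^bsub>G\<^esub>" "v = Some h" "h \<in> G_pow G d - {\<one>\<^bsub>G\<^esub>}"
      | h h' where "u = Some h" "v = Some h'" "h \<in> G_pow G d - {\<one>\<^bsub>G\<^esub>}" "h' \<in> G_pow G d"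
      using uv by blast
    then show ?thesis
    proof cases
      case 1
      have "Z_sh G Z (P None * P None) + Z_sh G Z (P None * P None) = 0 + 0"
        "Z_sh G Z (xx None * xx None) + Z_sh G Z (xx None * xx None) = 0 + 0"
        using P_swap[of None None] Z_sh_xx_mult[OF uvG] 1
        by (simp_all add: ZP0 Z_sh_x0 eq_neg_iff_add_eq_0)
      from this[THEN double_cancel] show ?thesis
        using 1 sigma_const[of 0] by simp
    next
      case 2
      then show ?thesis
        using main0h[of h] by (simp add: Z_sh_x0xg hG sigma_const)
    next
      case 3
      then show ?thesis
        using P_swap[of u v] Z_sh_xx_mult[OF uvG] main0h[of h]
        by (simp add: ZP0 Z_sh_x0 Z_sh_x0xg hG sigma_const)
    next
      case 4
      \<comment> \<open>\<open>x\<^sub>1 x\<^sub>1\<close> is half the shuffle square of \<open>x\<^sub>1\<close>.\<close>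
      have "Z_sh G Z (xx u * xx u) + Z_sh G Z (xx u * xx u) = [:0, 1:] ^ 2"
        using Z_sh_xx_mult[OF uvG] 4 by (simp add: Z_sh_x1 power2_eq_square eq_diff_eq)
      then have "sigma G d Z (Z_sh G Z (xx u * xx u)) + sigma G d Z (Z_sh G Z (xx u * xx u)) = [:c, 1:] ^ 2"
        by (simp only: sigma_add[symmetric] sigma_square)
      moreover have "Z_sh G Z (P u * P u) + Z_sh G Z (P u * P u) = [:c, 1:] ^ 2"
        using P_swap[of u u] 4 by (simp add: ZP1 power2_eq_square eq_diff_eq)
      ultimately show ?thesis
        using 4 by - (rule double_cancel, simp)
    next
      case 5
      \<comment> \<open>By the shuffle identity this reduces to the word \<open>x\<^sub>h x\<^sub>1\<close>, which is covered by the assumption \<open>iii\<close>.\<close>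
      have "Z_sh G Z (P (Some h) * P (Some \<one>\<^bsub>G\<^esub>)) = [:z2 h \<one>\<^bsub>G\<^esub>:]"
        using 5 one_pow by (simp add: Z_sh_HG0 HG0_PhPg Z_PhPg')
      then have "Z_sh G Z (P u * P v) = [:c, 1:] * [:z1 h:] - [:z2 h \<one>\<^bsub>G\<^esub>:]"
        using P_swap[of u v] 5 by (simp only: ZP1 ZPh)
      then have "Z_sh G Z (P u * P v) = [:- z2 h \<one>\<^bsub>G\<^esub> + z1 h * c, z1 h:]"
        by (simp add: algebra_simps)
      moreover have "Z_sh G Z (xx u * xx v) = [:- z2 h \<one>\<^bsub>G\<^esub>, z1 h:]"
        using 5 hG by (simp add: Z_sh_x1xg)
      ultimately show ?thesis by (simp add: sigma_linear)
    next
      case 6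
      then show ?thesis
        using hG by (simp add: Z_sh_HG0[OF HG0_PhPg] Z_PhPg' Z_sh_xgxh sigma_const)
    qed
  qed
  then show ?thesis
    by (simp add: P_def p_sharp_xx_xx i_sharp_xx_xx)
qed

end
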